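(* Let $\theta>0$, $\epsilon>0$, $n,N\ge1$, let $C:[0,\infty)\to\mathbb{R}^{n\times n}$ and $\Gamma:[0,\infty)\to\mathbb{R}^{n\times N}$ be continuous and $\theta$-periodic, and let $\boldsymbol{\Phi}(t)$ be the fundamental matrix, $\frac{d}{dt}\boldsymbol{\Phi}(t)=C(t)\boldsymbol{\Phi}(t)$, $\boldsymbol{\Phi}(0)=\mathbf{I}_n$. Assume $\boldsymbol{\Phi}(\theta)\in\overline{\mathbf{CM}}(n)$. Consider the linear SDE $$d\mathbf{Z}_\epsilon(t)=C(t)\mathbf{Z}_\epsilon(t)dt+\sqrt{\epsilon}\,\Gamma(t)d\mathbf{W}(t),$$ with $\mathbf{Z}_\epsilon(0)\sim\mathbb{N}_n(\mathbf{m},S)$ independent of the $N$-dimensional standard Brownian motion $\mathbf{W}$. Then: (a) for each $t\ge0$, $\mathbf{Z}_\epsilon(t)\sim\mathbb{N}_n(\boldsymbol{\Phi}(t)\mathbf{m},\Sigma(t))$ with $\Sigma(t)=\boldsymbol{\Phi}(t)\big[S+\epsilon\int_0^t(\boldsymbol{\Phi}^{-1}(s)\Gamma(s))(\boldsymbol{\Phi}^{-1}(s)\Gamma(s))^{\top}ds\big]\boldsymbol{\Phi}^{\top}(t)$; (b) the law of $\mathbf{Z}_\epsilon(t+\theta)$ equals the law of $\mathbf{Z}_\epsilon(t)$ for every $t\ge0$ if and only if $\mathbf{m}=\mathbf{0}$ and $S=\Sigma^c_\epsilon(0)$, where $\Sigma^c_\epsilon(0)$ is the unique real symmetric solution of $$\boldsymbol{\Phi}(\theta)\Sigma\boldsymbol{\Phi}(\theta)^{\top}-\Sigma+\epsilon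 M=\mathbb{O},\qquad M:=\int_0^\theta\big(\boldsymbol{\Phi}(\theta)\boldsymbol{\Phi}^{-1}(t)\Gamma(t)\big)\big(\boldsymbol{\Phi}(\theta)\boldsymbol{\Phi}^{-1}(t)\Gamma(t)\big)^{\top}dt;$$ in this case $\mathbf{Z}_\epsilon(t)\sim\mathbb{N}_n(\mathbf{0},\Sigma^c_\epsilon(t))$ with $\Sigma^c_\epsilon(t)=\boldsymbol{\Phi}(t)\big[\Sigma^c_\epsilon(0)+\epsilon\int_0^t(\boldsymbol{\Phi}^{-1}(s)\Gamma(s))(\boldsymbol{\Phi}^{-1}(s)\Gamma(s))^{\top}ds\big]\boldsymbol{\Phi}^{\top}(t)$, which is $\theta$-periodic; (c) let $\xi=\operatorname{rank}M$, and let $\mathcal{G}_0$ be an orthogonal matrix with $\mathcal{G}_0M\mathcal{G}_0^{\top}=\sum_{k=1}^{\xi}\lambda_k^{+}E_{n,\phi_k}$, where $\lambda_k^+>0$ and $1\le\phi_1<\dots<\phi_\xi\le n$; let $A_{[1]}=\mathcal{G}_0\boldsymbol{\Phi}(\theta)\mathcal{G}_0^{-1}$ and, for each $k$, let $\Sigma_{[1]\phi_k}$ be the unique real symmetric solution of $A_{[1]}\Sigma A_{[1]}^{\top}-\Sigma+E_{n,\phi_k}=\mathbb{O}$. Then each $\Sigma_{[1]\phi_k}$ is positive semidefinite and $$\Sigma^c_\epsilon(0)=\epsilon\,\mathcal{G}_0^{\top}\Big(\sum_{k=1}^{\xi}\lambda_k^{+}\Sigma_{[1]\phi_k}\Big)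\mathcal{G}_0\succeq\mathbb{O}.$$
   Context: $\overline{\mathbf{CM}}(n)$ denotes the set of real $n\times n$ matrices all of whose eigenvalues $\lambda$ satisfy $0<|\lambda|<1$. $E_{n,j}$ is the $n\times n$ diagonal matrix with a single $1$ in position $(j,j)$ and zeros elsewhere. $A\succeq B$ means $A-B$ is positive semidefinite. $\mathbb{N}_n(\mu,\Sigma)$ is the $n$-dimensional Gaussian law with mean $\mu$ and covariance $\Sigma$. (In the paper this linear SDE is the linearization of a stochastic Kolmogorov system around a $\theta$-periodic solution $\mathbf{X}^\star(t)$ of its deterministic part, with $C(t)$ the Jacobian of the drift at $\mathbf{X}^\star(t)$ and $\Gamma(t)$ the noise matrix evaluated at $\mathbf{X}^\star(t)$.) *)

theory Defs
  imports "HOL-Analysis.Analysis" "HOL-Probability.Probability"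
begin

definition cmat :: "real^'n^'n \<Rightarrow> complex^'n^'n" where
  "cmat A = (\<chi> i j. complex_of_real (A $ i $ j))"

definition eigenvalue_of :: "real^'n^'n \<Rightarrow> complex \<Rightarrow> bool" where
  "eigenvalue_of A z \<longleftrightarrow> (\<exists>v. v \<noteq> 0 \<and> cmat A *v v = z *s v)"

definition CM_bar :: "real^'n^'n \<Rightarrow> bool" where
  "CM_bar A \<longleftrightarrow> (\<forall>z. eigenvalue_of A z \<longrightarrow> 0 < cmod z \<and> cmod z < 1)"

definition Emat :: "'n \<Rightarrow> real^'n^'n" where
  "Emat j = (\<chi> a b. if a = j \<and> b = j then 1 else 0)"

definition psd :: "real^'n^'n \<Rightarrow> bool" where
  "psd A \<longleftrightarrow> (\<forall>x. 0 \<le> x \<bullet> (A *v x))"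

definition gaussian_law :: "'a measure \<Rightarrow> ('a \<Rightarrow> real^'n) \<Rightarrow> real^'n \<Rightarrow> real^'n^'n \<Rightarrow> bool" where
  "gaussian_law M X m S \<longleftrightarrow>
     X \<in> borel_measurable M \<and> transpose S = S \<and> psd S \<and>
     (\<forall>u. integral\<^sup>L M (\<lambda>\<omega>. cis (u \<bullet> X \<omega>))
           = cis (u \<bullet> m) * complex_of_real (exp (- (u \<bullet> (S *v u)) / 2)))"

definition std_brownian_motion :: "'a measure \<Rightarrow> (real \<Rightarrow> 'a \<Rightarrow> real^'k) \<Rightarrow> bool" where
  "std_brownian_motion M W \<longleftrightarrow>
     (\<forall>t. W t \<in> borel_measurable M) \<and>
     (\<forall>\<omega>\<in>space M. W 0 \<omega> = 0 \<and> continuous_on {0..} (\<lambda>t. W t \<omega>)) \<and>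
     (\<forall>s t. 0 \<le> s \<and> s < t \<longrightarrow>
        gaussian_law M (\<lambda>\<omega>. W t \<omega> - W s \<omega>) 0 ((t - s) *\<^sub>R mat 1)) \<and>
     (\<forall>(ts :: nat \<Rightarrow> real) k. 0 \<le> ts 0 \<and> (\<forall>i<k. ts i < ts (Suc i)) \<longrightarrow>
        prob_space.indep_vars M (\<lambda>_. borel) (\<lambda>i \<omega>. W (ts (Suc i)) \<omega> - W (ts i) \<omega>) {..<k})"

definition riemann_sum_dW ::
  "(real \<Rightarrow> real^'k^'n) \<Rightarrow> (real \<Rightarrow> 'a \<Rightarrow> real^'k) \<Rightarrow> real \<Rightarrow> nat \<Rightarrow> 'a \<Rightarrow> real^'n" where
  "riemann_sum_dW \<Gamma> W t n \<omega> =
     (\<Sum>j<n. \<Gamma> (real j * t / real n) *v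
              (W (real (Suc j) * t / real n) \<omega> - W (real j * t / real n) \<omega>))"

definition is_wiener_integral ::
  "'a measure \<Rightarrow> (real \<Rightarrow> real^'k^'n) \<Rightarrow> (real \<Rightarrow> 'a \<Rightarrow> real^'k) \<Rightarrow> real \<Rightarrow> ('a \<Rightarrow> real^'n) \<Rightarrow> bool" where
  "is_wiener_integral M \<Gamma> W t I \<longleftrightarrow>
     I \<in> borel_measurable M \<and>
     (\<forall>e>0. (\<lambda>n. measure M {\<omega>\<in>space M. e < dist (riemann_sum_dW \<Gamma> W t n \<omega>) (I \<omega>)})
              \<longlonglongrightarrow> 0)"

definition linear_sde_solution ::
  "'a measure \<Rightarrow> (real \<Rightarrow> real^'n^'n) \<Rightarrow> (real \<Rightarrow> real^'k^'n) \<Rightarrow> real \<Rightarrow>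
   (real \<Rightarrow> 'a \<Rightarrow> real^'k) \<Rightarrow> (real \<Rightarrow> 'a \<Rightarrow> real^'n) \<Rightarrow> bool" where
  "linear_sde_solution M C \<Gamma> \<epsilon> W Z \<longleftrightarrow>
     (\<forall>t. Z t \<in> borel_measurable M) \<and>
     (\<forall>\<omega>\<in>space M. continuous_on {0..} (\<lambda>t. Z t \<omega>)) \<and>
     (\<forall>t\<ge>0. \<exists>I. is_wiener_integral M \<Gamma> W t I \<and>
        (AE \<omega> in M. Z t \<omega> = Z 0 \<omega> + integral {0..t} (\<lambda>s. C s *v Z s \<omega>) + sqrt \<epsilon> *\<^sub>R I \<omega>))"

end

theory Submission
  imports Defs "HOL-Computational_Algebra.Fundamental_Theorem_Algebra"
begin

text \<open>With \<open>\<Psi> = \<Phi>\<^sup>-\<^sup>1\<close>, the variation of constants formula says that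
  \<open>\<Psi>(T) Z(T) - Z(0)\<close> is \<open>sqrt \<epsilon>\<close> times the Wiener integral of \<open>\<Psi> \<Gamma>\<close>. It is obtained as a pathwise
  limit of sums of \<open>\<Psi>\<close> times noise increments, each of which is a limit in probability of Riemann
  sums of independent Gaussian increments. So the characteristic functions of the approximations
  are explicit and converge to the Gaussian one. Over a period the covariance evolves by
  \<open>S \<mapsto> \<Phi>(\<theta>) S \<Phi>(\<theta>)\<^sup>T + \<epsilon> M\<close>; as the powers of \<open>\<Phi>(\<theta>)\<close> tend to zero, this map has exactly one
  fixed point, which is positive semidefinite and depends linearly on \<open>M\<close>, and the mean has the
  only fixed point \<open>0\<close>. Laws are compared through their characteristic functions.\<close>

section \<open>Power-stable matrices and the Stein equation\<close>

text \<open>The Wiener integral is given for one time \<open>t\<close> at a time, as a limit in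
  probability of left-endpoint Riemann sums on the uniform grid of \<open>{0..t}\<close>, and the
  equation holds almost surely at each time. So there is no integral process to manipulate, and two
  kinds of limit have to be combined: refining the Brownian grid under a fixed coarse grid converges
  in probability, refining the coarse grid converges along almost every path. A diagonal choice of
  the refinements merges them. Gaussian laws are encoded by characteristic functions, which survive
  both limits and cover degenerate covariances uniformly; the price is a uniqueness theorem for
  characteristic functions in several dimensions. On the algebraic side no matrix series is summed:
  forms are followed along the orbits of the transposed matrix, for which convergence of single
  orbits suffices.\<close>

lemma bounded_bilinear_matrix_mult:
  "bounded_bilinear ((**) :: real^'n^'m \<Rightarrow> real^'k^'n \<Rightarrow> real^'k^'m)"
  unfolding bilinear_conv_bounded_bilinear[symmetric] bilinear_def
  by (auto intro!: linearI simp: matrix_matrix_mult_def vec_eq_iff algebra_simps sum.distrib sum_distrib_left)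

lemma bounded_bilinear_matrix_vector_mult:
  "bounded_bilinear ((*v) :: real^'n^'m \<Rightarrow> real^'n \<Rightarrow> real^'m)"
  unfolding bilinear_conv_bounded_bilinear[symmetric] bilinear_def
  by (auto intro!: linearI simp: matrix_vector_mult_def vec_eq_iff algebra_simps sum.distrib sum_distrib_left)

text \<open>Covariances evolve by congruence; as a bounded linear map it can be pulled through sums
  and integrals of matrices.\<close>

lemma bounded_linear_congruence:
  "bounded_linear (\<lambda>S. A ** S ** B)" for A :: "real^'n^'m" and B :: "real^'l^'k"
  using bounded_linear_compose[OF bounded_bilinear.bounded_linear_left[OF bounded_bilinear_matrix_mult, of B]
     bounded_bilinear.bounded_linear_right[OF bounded_bilinear_matrix_mult, of A]] .

lemma bounded_linear_transpose: "bounded_linear (transpose :: real^'n^'m \<Rightarrow> real^'m^'n)"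
  unfolding linear_conv_bounded_linear[symmetric]
  by (auto intro!: linearI simp: transpose_def vec_eq_iff)

lemmas continuous_on_matrix_mult [continuous_intros] = bounded_bilinear.continuous_on[OF bounded_bilinear_matrix_mult]
lemmas tendsto_matrix_vector_mult [tendsto_intros] = bounded_bilinear.tendsto[OF bounded_bilinear_matrix_vector_mult]
lemmas continuous_on_matrix_vector_mult [continuous_intros] = bounded_bilinear.continuous_on[OF bounded_bilinear_matrix_vector_mult]
lemmas continuous_on_transpose [continuous_intros] = bounded_linear.continuous_on[OF bounded_linear_transpose]

text \<open>Once \<open>b\<close> is below \<open>e / 2 * (1 - norm z)\<close>, a bound by a
  geometric term plus \<open>e / 2\<close> reproduces itself, since \<open>e / 2\<close> is the
  fixed point of \<open>r \<mapsto> norm z * r + e / 2 * (1 - norm z)\<close>.\<close>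

lemma tendsto_zero_affine_recurrence:
  fixes a b :: "nat \<Rightarrow> 'a::real_normed_div_algebra"
  assumes rec: "\<And>k. a (Suc k) = z * a k + b k" and z: "norm z < 1" and b: "b \<longlonglongrightarrow> 0"
  shows "a \<longlonglongrightarrow> 0"
proof (rule LIMSEQ_I)
  fix e :: real assume e: "e > 0"
  then have "e / 2 * (1 - norm z) > 0" using z by simp
  then obtain K where K: "\<And>k. k \<ge> K \<Longrightarrow> norm (b k) < e / 2 * (1 - norm z)"
    using LIMSEQ_D[OF b] by (metis diff_zero)
  have bound: "norm (a (K + m)) \<le> norm z ^ m * norm (a K) + e / 2" for m
  proof (induction m)
    case 0 then show ?case using e by simp
  next
    case (Suc m)
    have "norm (a (K + Suc m)) \<le> norm z * norm (a (K + m)) + norm (b (K + m))"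
      using rec[of "K + m"] by (metis add_Suc_right norm_mult norm_triangle_ineq)
    also have "\<dots> \<le> norm z * (norm z ^ m * norm (a K) + e / 2) + e / 2 * (1 - norm z)"
      using K[of "K + m"] by (intro add_mono mult_left_mono Suc) auto
    also have "\<dots> = norm z ^ Suc m * norm (a K) + e / 2" by (simp add: field_simps)
    finally show ?case .
  qed
  have "(\<lambda>m. norm z ^ m * norm (a K)) \<longlonglongrightarrow> 0"
    using z by (intro tendsto_mult_left_zero LIMSEQ_power_zero) simp
  then have "\<forall>\<^sub>F m in sequentially. norm z ^ m * norm (a K) < e / 2"
    by (rule order_tendstoD) (use e in simp)
  then obtain m0 where m0: "\<And>m. m \<ge> m0 \<Longrightarrow> norm z ^ m * norm (a K) < e / 2"
    by (auto simp: eventually_sequentially)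
  have "norm (a k - 0) < e" if "k \<ge> K + m0" for k
    using bound[of "k - K"] m0[of "k - K"] that by (simp only: le_add_diff_inverse diff_zero) linarith
  then show "\<exists>no. \<forall>n\<ge>no. norm (a n - 0) < e" by blast
qed

text \<open>Peeling off the roots of the annihilating polynomial one by one: a root that is not an
  eigenvalue can be dropped, and an eigenvalue in the unit disc gives an affine recurrence.\<close>

lemma matrix_powers_tendsto_zero_complex:
  fixes B :: "complex^'n^'n"
  assumes ev: "\<And>z v. v \<noteq> 0 \<Longrightarrow> B *v v = z *s v \<Longrightarrow> cmod z < 1"
    and "p \<noteq> 0" "degree p \<le> d" "(\<Sum>i\<le>d. coeff p i *s (((*v) B ^^ i) x)) = 0"
  shows "(\<lambda>k. ((*v) B ^^ k) x) \<longlonglongrightarrow> 0"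
  using assms(2-)
proof (induction d arbitrary: p x)
  case 0
  then have "coeff p 0 \<noteq> 0" by (metis le_zero_eq leading_coeff_0_iff)
  then have x: "x = 0" using 0 by (simp add: vec_eq_iff)
  have "((*v) B ^^ k) 0 = 0" for k by (induction k) auto
  then show ?case using x by simp
next
  case (Suc d)
  let ?T = "(*v) B"
  have add: "(?T ^^ i) (u - c *s w) = (?T ^^ i) u - c *s (?T ^^ i) w" for i u w c
    by (induction i) (auto simp: matrix_vector_mult_diff_distrib vector_scalar_commute)
  show ?case
  proof (cases "degree p = 0")
    case True
    then have "(\<Sum>i\<le>Suc d. coeff p i *s ((?T ^^ i) x)) = coeff p 0 *s x + (\<Sum>i\<le>d. coeff p (Suc i) *s ((?T ^^ Suc i) x))"
      by (subst sum.atMost_Suc_shift) simp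
    also have "(\<Sum>i\<le>d. coeff p (Suc i) *s ((?T ^^ Suc i) x)) = 0"
      using True by (intro sum.neutral) (auto simp: coeff_eq_0)
    finally have "coeff p 0 *s x = 0" using Suc.prems by simp
    moreover have "coeff p 0 \<noteq> 0" using True Suc.prems by (metis leading_coeff_0_iff)
    ultimately have x: "x = 0" by (simp add: vec_eq_iff)
    have "(?T ^^ k) 0 = 0" for k by (induction k) auto
    then show ?thesis using x by simp
  next
    case False
    then obtain z where "poly p z = 0"
      using fundamental_theorem_of_algebra[of p] by (auto simp: constant_degree)
    then obtain q where pq: "p = [:-z, 1:] * q" by (metis dvdE poly_eq_0_iff_dvd)
    have q0: "q \<noteq> 0" using pq Suc.prems by auto
    have "degree p = Suc (degree q)" unfolding pq by (subst degree_mult_eq) (use q0 in auto)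
    then have dq: "degree q \<le> d" using Suc.prems by simp
    have cp: "coeff p i = coeff (pCons 0 q) i - z * coeff q i" for i
      unfolding pq by simp
    \<comment> \<open>With \<open>p = (X - z) q\<close> there are two readings of
      \<open>p(B) x = 0\<close>: as \<open>q(B) y = 0\<close>, which feeds the induction hypothesis,
      and as \<open>(B - z) w = 0\<close> for \<open>w = q(B) x\<close>, which makes
      \<open>w\<close> zero or an eigenvector.\<close>
    define y where "y = B *v x - z *s x"
    define w where "w = (\<Sum>i\<le>d. coeff q i *s ((?T ^^ i) x))"
    have "(\<Sum>i\<le>Suc d. coeff p i *s ((?T ^^ i) x)) =
       (\<Sum>i\<le>Suc d. coeff (pCons 0 q) i *s ((?T ^^ i) x)) - (\<Sum>i\<le>Suc d. (z * coeff q i) *s ((?T ^^ i) x))"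
      by (simp add: cp vector_ssub_ldistrib sum_subtractf[symmetric] vec.scale_left_diff_distrib del: sum.atMost_Suc)
    also have "(\<Sum>i\<le>Suc d. coeff (pCons 0 q) i *s ((?T ^^ i) x)) = (\<Sum>i\<le>d. coeff q i *s ((?T ^^ i) (?T x)))"
      by (subst sum.atMost_Suc_shift) (simp add: funpow_swap1)
    also have "(\<Sum>i\<le>Suc d. (z * coeff q i) *s ((?T ^^ i) x)) = (\<Sum>i\<le>d. (z * coeff q i) *s ((?T ^^ i) x))"
      using dq by (simp add: coeff_eq_0)
    also have "(\<Sum>i\<le>d. coeff q i *s ((?T ^^ i) (?T x))) - \<dots> = (\<Sum>i\<le>d. coeff q i *s ((?T ^^ i) y))"
      unfolding y_def add
      by (simp add: sum_subtractf[symmetric] vec.scale_right_diff_distrib mult.commute)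
    finally have y: "(\<Sum>i\<le>d. coeff q i *s ((?T ^^ i) y)) = 0" using Suc.prems by simp
    have "(\<Sum>i\<le>d. coeff q i *s ((?T ^^ i) y)) = B *v w - z *s w"
      unfolding y_def w_def add
      by (simp add: sum_subtractf matrix_vector_mult_diff_distrib vec.scale_right_diff_distrib
           vec.scale_sum_right vec.linear_sum[OF matrix_vector_mul_linear_gen] vector_scalar_commute funpow_swap1 mult.commute)
    with y have w: "B *v w = z *s w" by simp
    show ?thesis
    proof (cases "cmod z < 1")
      case True
      have ylim: "(\<lambda>k. (?T ^^ k) y) \<longlonglongrightarrow> 0" by (rule Suc.IH[OF q0 dq y])
      show ?thesis
      proof (rule vec_tendstoI)
        fix i
        show "(\<lambda>k. (?T ^^ k) x $ i) \<longlonglongrightarrow> 0 $ i"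
          unfolding zero_index
        proof (rule tendsto_zero_affine_recurrence[OF _ True])
          show "(\<lambda>k. (?T ^^ k) y $ i) \<longlonglongrightarrow> 0" using tendsto_vec_nth[OF ylim, of i] by simp
          show "(?T ^^ Suc k) x $ i = z * (?T ^^ k) x $ i + (?T ^^ k) y $ i" for k
            unfolding y_def add by (simp add: funpow_swap1)
        qed
      qed
    next
      case False
      then have "w = 0" using ev[of w z] w by blast
      then show ?thesis using Suc.IH[OF q0 dq] unfolding w_def by blast
    qed
  qed
qed

text \<open>In finite dimension this is spectral radius below one. Stated through real orbits it
  confines the complex spectrum to a single lemma.\<close>

definition power_stable :: "real^'n^'n \<Rightarrow> bool" where
  "power_stable A \<longleftrightarrow> (\<forall>x. (\<lambda>k. ((*v) A ^^ k) x) \<longlonglongrightarrow> 0)"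

text \<open>A pointwise substitute for Cayley-Hamilton, with a polynomial that depends on
  \<open>x\<close>. Too many distinct iterates are linearly dependent; a repeated iterate is a case
  of its own, because \<open>dependent\<close> speaks of sets and does not see repetitions.\<close>

lemma annihilating_polynomial:
  fixes T :: "'a::euclidean_space \<Rightarrow> 'a"
  obtains c :: "nat \<Rightarrow> real" and j where "j \<le> DIM('a)" "c j \<noteq> 0" "(\<Sum>i\<le>DIM('a). c i *\<^sub>R (T ^^ i) x) = 0"
proof (cases "inj_on (\<lambda>i. (T ^^ i) x) {..DIM('a)}")
  case True
  let ?S = "(\<lambda>i. (T ^^ i) x) ` {..DIM('a)}"
  have "card ?S = Suc DIM('a)" using True by (simp add: card_image)
  then have "dependent ?S" by (intro dependent_biggerset) auto
  then obtain u where u: "\<exists>v\<in>?S. u v \<noteq> 0" "(\<Sum>v\<in>?S. u v *\<^sub>R v) = 0"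
    by (auto simp: dependent_finite)
  from u(1) obtain j where "j \<le> DIM('a)" "u ((T ^^ j) x) \<noteq> 0" by auto
  moreover have "(\<Sum>i\<le>DIM('a). u ((T ^^ i) x) *\<^sub>R (T ^^ i) x) = 0"
    using u(2) by (simp add: sum.reindex[OF True])
  ultimately show ?thesis using that[of j "\<lambda>i. u ((T ^^ i) x)"] by blast
next
  case False
  then obtain i j where ij: "i \<le> DIM('a)" "j \<le> DIM('a)" "i \<noteq> j" "(T ^^ i) x = (T ^^ j) x"
    by (auto simp: inj_on_def)
  let ?c = "\<lambda>l. if l = i then 1 else if l = j then -1 else (0::real)"
  have "(\<Sum>l\<le>DIM('a). ?c l *\<^sub>R (T ^^ l) x) = (\<Sum>l\<in>{i,j}. ?c l *\<^sub>R (T ^^ l) x)"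
    using ij by (intro sum.mono_neutral_right) auto
  also have "\<dots> = 0" using ij by simp
  finally show ?thesis using ij that[of i ?c] by simp
qed

text \<open>The annihilating polynomial is real but its roots are not, so the orbit is complexified
  by \<open>cv\<close>, which intertwines \<open>A\<close> with \<open>cmat A\<close>; taking real
  parts returns the limit.\<close>

lemma CM_bar_imp_power_stable:
  fixes A :: "real^'n^'n"
  assumes "CM_bar A"
  shows "power_stable A"
  unfolding power_stable_def
proof
  fix x :: "real^'n"
  define cv :: "real^'n \<Rightarrow> complex^'n" where "cv = (\<lambda>x. \<chi> i. complex_of_real (x $ i))"
  have cv: "cv (A *v x) = cmat A *v cv x" for x
    by (simp add: cv_def cmat_def matrix_vector_mult_def vec_eq_iff)
  have cvp: "cv (((*v) A ^^ k) x) = ((*v) (cmat A) ^^ k) (cv x)" for k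
    by (induction k) (simp_all add: cv)
  obtain c :: "nat \<Rightarrow> real" and j where j: "j \<le> DIM(real^'n)" "c j \<noteq> 0"
    and sum: "(\<Sum>i\<le>DIM(real^'n). c i *\<^sub>R ((*v) A ^^ i) x) = 0"
    by (rule annihilating_polynomial[of "(*v) A" x])
  define p where "p = (\<Sum>i\<le>DIM(real^'n). monom (complex_of_real (c i)) i)"
  have cp: "coeff p i = (if i \<le> DIM(real^'n) then complex_of_real (c i) else 0)" for i
    by (simp add: p_def coeff_sum)
  have "p \<noteq> 0" using cp[of j] j by auto
  moreover have "degree p \<le> DIM(real^'n)" by (rule degree_le) (simp add: cp)
  moreover have "(\<Sum>i\<le>DIM(real^'n). coeff p i *s (((*v) (cmat A) ^^ i) (cv x))) =
      cv (\<Sum>i\<le>DIM(real^'n). c i *\<^sub>R ((*v) A ^^ i) x)"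
    by (simp add: cp cvp[symmetric]) (simp add: cv_def vec_eq_iff)
  moreover have "cv 0 = 0" by (simp add: cv_def vec_eq_iff)
  ultimately have "(\<lambda>k. ((*v) (cmat A) ^^ k) (cv x)) \<longlonglongrightarrow> 0"
    using assms sum unfolding CM_bar_def eigenvalue_of_def
    by (intro matrix_powers_tendsto_zero_complex[where p=p and d="DIM(real^'n)"]) auto
  then have "(\<lambda>k. cv (((*v) A ^^ k) x)) \<longlonglongrightarrow> 0" by (simp add: cvp)
  then have "(\<lambda>k. Re (cv (((*v) A ^^ k) x) $ i)) \<longlonglongrightarrow> Re ((0::complex^'n) $ i)" for i
    by (intro tendsto_intros)
  then show "(\<lambda>k. ((*v) A ^^ k) x) \<longlonglongrightarrow> 0"
    by (intro vec_tendstoI) (simp add: cv_def)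
qed


text \<open>As a simp rule, \<open>transpose_matrix_vector\<close> would hide every \<open>transpose A *v x\<close> as \<open>x v* A\<close>.\<close>

declare transpose_matrix_vector [simp del]

section \<open>Duality of orbits and the Stein equation\<close>

lemma dot_matrix_vector_mult: "x \<bullet> (A *v y) = (transpose A *v x) \<bullet> y"
  for A :: "real^'n^'m"
  by (simp add: dot_lmul_matrix transpose_matrix_vector)

lemma dot_funpow_transpose:
  fixes A :: "real^'n^'n"
  shows "(((*v) (transpose A) ^^ k) x) \<bullet> y = x \<bullet> (((*v) A ^^ k) y)"
proof (induction k arbitrary: x y)
  case (Suc k)
  have "(((*v) (transpose A) ^^ Suc k) x) \<bullet> y = (((*v) (transpose A) ^^ k) (transpose A *v x)) \<bullet> y"
    by (simp only: funpow_Suc_right o_apply)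
  also have "\<dots> = (transpose A *v x) \<bullet> (((*v) A ^^ k) y)" by (rule Suc.IH)
  also have "\<dots> = x \<bullet> (((*v) A ^^ Suc k) y)"
    by (simp add: dot_matrix_vector_mult[symmetric])
  finally show ?case .
qed simp

text \<open>Congruence by \<open>A\<close> moves the argument of a form along the orbit of
  \<open>transpose A\<close>. The coordinates of that orbit are pairings of \<open>x\<close> with
  the orbits of the basis vectors under \<open>A\<close>.\<close>

lemma power_stable_transpose:
  fixes A :: "real^'n^'n"
  assumes "power_stable A" shows "power_stable (transpose A)"
  unfolding power_stable_def
proof (intro allI vec_tendstoI)
  fix x :: "real^'n" and i
  have "(\<lambda>k. x \<bullet> (((*v) A ^^ k) (axis i 1))) \<longlonglongrightarrow> x \<bullet> 0"
    using assms unfolding power_stable_def by (intro tendsto_intros) auto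
  then show "(\<lambda>k. (((*v) (transpose A) ^^ k) x) $ i) \<longlonglongrightarrow> 0 $ i"
    by (simp add: dot_funpow_transpose[symmetric] inner_axis)
qed

lemma dot_congruence: "x \<bullet> ((B ** S ** transpose B) *v y) = (transpose B *v x) \<bullet> (S *v (transpose B *v y))"
  for B :: "real^'n^'m" and S :: "real^'n^'n"
  by (simp add: matrix_vector_mul_assoc[symmetric] dot_matrix_vector_mult[of x B])

lemma matrix_eq_iff_dot:
  fixes S T :: "real^'n^'m" shows "S = T \<longleftrightarrow> (\<forall>x y. x \<bullet> (S *v y) = x \<bullet> (T *v y))"
  by (metis matrix_eq vector_eq_ldot)

text \<open>The bilinear form of \<open>S\<close> is constant along pairs of transposed orbits, and
  these tend to zero.\<close>

lemma stein_homogeneous_imp_zero: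
  fixes A :: "real^'n^'n"
  assumes "power_stable A" and eq: "A ** S ** transpose A - S = 0"
  shows "S = 0"
proof -
  let ?y = "\<lambda>x k. ((*v) (transpose A) ^^ k) x"
  have "x \<bullet> (S *v w) = 0" for x w
  proof -
    have "?y x k \<bullet> (S *v ?y w k) = x \<bullet> (S *v w)" for k
    proof (induction k)
      case (Suc k)
      have "?y x (Suc k) \<bullet> (S *v ?y w (Suc k)) = ?y x k \<bullet> ((A ** S ** transpose A) *v ?y w k)"
        by (simp add: dot_congruence)
      then show ?case using eq Suc by simp
    qed simp
    moreover have "(\<lambda>k. ?y x k \<bullet> (S *v ?y w k)) \<longlonglongrightarrow> 0 \<bullet> (S *v 0)"
      using power_stable_transpose[OF assms(1)] unfolding power_stable_def
      by (intro tendsto_intros) auto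
    ultimately show ?thesis by (simp add: LIMSEQ_const_iff)
  qed
  then show ?thesis by (simp add: matrix_eq_iff_dot)
qed

text \<open>The operator \<open>L\<close> is injective, hence surjective on the finite-dimensional
  space of matrices. It commutes with transposition, so injectivity also makes the solution
  symmetric.\<close>

lemma stein_ex1:
  fixes A Q :: "real^'n^'n"
  assumes A: "power_stable A" and Q: "transpose Q = Q"
  shows "\<exists>!S. transpose S = S \<and> A ** S ** transpose A - S + Q = 0"
proof -
  define L where "L = (\<lambda>S. A ** S ** transpose A - S)"
  have lin: "linear L"
    unfolding L_def
    by (intro bounded_linear.linear bounded_linear_sub bounded_linear_ident bounded_linear_congruence)
  have inj: "inj L"
    unfolding linear_injective_0[OF lin] using stein_homogeneous_imp_zero[OF A] by (auto simp: L_def)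
  then obtain S where S: "L S = - Q"
    using linear_injective_imp_surjective[OF lin] by (metis surjD)
  have trL: "transpose (L T) = L (transpose T)" for T
    by (simp add: L_def matrix_transpose_mul matrix_mul_assoc linear_diff[OF bounded_linear.linear, OF bounded_linear_transpose])
  have "L (transpose S) = L S"
    using S Q trL[of S] by (simp add: linear_neg bounded_linear.linear[OF bounded_linear_transpose])
  then have "transpose S = S" using inj by (simp add: inj_eq)
  moreover have "L T + Q = 0 \<longleftrightarrow> T = S" for T
    using inj by (metis S eq_neg_iff_add_eq_0 injD)
  ultimately show ?thesis unfolding L_def by metis
qed

text \<open>Along a transposed orbit the form of \<open>S\<close> drops at each step by a
  nonnegative value of the form of \<open>Q\<close>. Its limit is zero, so it cannot start
  negative.\<close>

lemma stein_psd:
  fixes A Q S :: "real^'n^'n"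
  assumes A: "power_stable A" and Q: "psd Q" and eq: "A ** S ** transpose A - S + Q = 0"
  shows "psd S"
  unfolding psd_def
proof
  fix x
  let ?y = "\<lambda>k. ((*v) (transpose A) ^^ k) x"
  have S: "S = A ** S ** transpose A + Q" using eq by (simp add: algebra_simps)
  have "?y (Suc k) \<bullet> (S *v ?y (Suc k)) \<le> ?y k \<bullet> (S *v ?y k)" for k
  proof -
    have "?y k \<bullet> (S *v ?y k) = ?y (Suc k) \<bullet> (S *v ?y (Suc k)) + ?y k \<bullet> (Q *v ?y k)"
      by (subst (1) S) (simp add: matrix_vector_mult_add_rdistrib inner_add_right dot_congruence)
    then show ?thesis using Q by (simp add: psd_def)
  qed
  then have "antimono (\<lambda>k. ?y k \<bullet> (S *v ?y k))" by (simp add: antimono_iff_le_Suc)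
  moreover have "(\<lambda>k. ?y k \<bullet> (S *v ?y k)) \<longlonglongrightarrow> 0 \<bullet> (S *v 0)"
    using power_stable_transpose[OF A] unfolding power_stable_def
    by (intro tendsto_intros) auto
  ultimately show "0 \<le> x \<bullet> (S *v x)"
    using decseq_ge[of "\<lambda>k. ?y k \<bullet> (S *v ?y k)" 0 0] by simp
qed

lemma power_stable_orthogonal_conj:
  fixes A G :: "real^'n^'n"
  assumes A: "power_stable A" and G: "orthogonal_matrix G"
  shows "power_stable (G ** A ** transpose G)"
  unfolding power_stable_def
proof
  fix x
  have GG: "transpose G ** G = mat 1" "G ** transpose G = mat 1" using G by (auto simp: orthogonal_matrix_def)
  have "((*v) (G ** A ** transpose G) ^^ k) x = G *v (((*v) A ^^ k) (transpose G *v x))" for k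
  proof (induction k)
    case 0 show ?case by (simp add: matrix_vector_mul_assoc GG)
  next
    case (Suc k)
    have "transpose G *v (G *v y) = y" for y by (simp add: matrix_vector_mul_assoc GG)
    then show ?case unfolding funpow.simps o_apply Suc by (simp add: matrix_vector_mul_assoc[symmetric])
  qed
  moreover have "(\<lambda>k. G *v (((*v) A ^^ k) (transpose G *v x))) \<longlonglongrightarrow> G *v 0"
    using A unfolding power_stable_def by (intro tendsto_intros) auto
  ultimately show "(\<lambda>k. ((*v) (G ** A ** transpose G) ^^ k) x) \<longlonglongrightarrow> 0" by simp
qed

lemma psd_Emat: "psd (Emat j)"
proof -
  have "Emat j *v x = (x $ j) *\<^sub>R axis j 1" for x
    by (auto simp: vec_eq_iff matrix_vector_mult_def Emat_def axis_def if_distrib if_distribR cong: if_cong)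
  then show ?thesis by (simp add: psd_def inner_axis)
qed

lemma transpose_Emat: "transpose (Emat j) = Emat j"
  by (auto simp: Emat_def transpose_def vec_eq_iff)

section \<open>Characteristic functions determine laws on Euclidean spaces\<close>

text \<open>The complex span of the characters. Equality of characteristic functions extends to it
  by linearity, and it is closed under products because frequencies add.\<close>

inductive trig_sum :: "('a::real_inner \<Rightarrow> complex) \<Rightarrow> bool" where
  cis: "trig_sum (\<lambda>x. cis (u \<bullet> x))"
| add: "trig_sum f \<Longrightarrow> trig_sum g \<Longrightarrow> trig_sum (\<lambda>x. f x + g x)"
| scale: "trig_sum f \<Longrightarrow> trig_sum (\<lambda>x. c * f x)"

lemma trig_sum_const: "trig_sum (\<lambda>x. c)"
  using trig_sum.scale[OF trig_sum.cis[of 0], of c] by simp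

lemma trig_sum_mult:
  assumes "trig_sum f" "trig_sum g" shows "trig_sum (\<lambda>x. f x * g x)"
  using assms
proof (induction arbitrary: g)
  case (cis u)
  from \<open>trig_sum g\<close> show ?case
  proof induction
    case (cis v) show ?case using trig_sum.cis[of "u + v"] by (simp add: inner_add_left cis_mult)
  next
    case (add f g) then show ?case using trig_sum.add by (simp add: distrib_left)
  next
    case (scale f c) then show ?case using trig_sum.scale[OF scale.IH, of c] by (simp add: mult_ac)
  qed
next
  case (add f1 f2)
  then show ?case using trig_sum.add[OF add.IH(1)[OF add.prems] add.IH(2)[OF add.prems]] by (simp add: distrib_right)
next
  case (scale f c)
  then show ?case using trig_sum.scale[OF scale.IH[OF scale.prems], of c] by (simp add: mult_ac)
qed

lemma trig_sum_sum: "(\<And>i. i \<in> I \<Longrightarrow> trig_sum (f i)) \<Longrightarrow> trig_sum (\<lambda>x. \<Sum>i\<in>I. f i x)"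
  by (induction I rule: infinite_finite_induct) (auto intro: trig_sum_const trig_sum.add)

lemma trig_sum_sin: "trig_sum (\<lambda>x. complex_of_real (sin (u \<bullet> x)))"
proof -
  have "complex_of_real (sin (u \<bullet> x)) = (- \<i> / 2) * cis (u \<bullet> x) + (\<i> / 2) * cis ((- u) \<bullet> x)" for x
    by (simp add: complex_eq_iff)
  then show ?thesis
    by (simp only:) (intro trig_sum.add trig_sum.scale trig_sum.cis)
qed

text \<open>Polynomials in the sines of \<open>x \<bullet> b / L\<close> are trigonometric sums, and \<open>L\<close> times the sine map
  tends to the identity as \<open>L \<rightarrow> \<infinity>\<close>. Precomposing a bounded continuous function with it makes
  Weierstrass approximation uniform on the whole space, because the sines stay in a cube.\<close>

definition sin_map :: "real \<Rightarrow> 'a::euclidean_space \<Rightarrow> 'a" where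
  "sin_map L x = (\<Sum>b\<in>Basis. sin ((b /\<^sub>R L) \<bullet> x) *\<^sub>R b)"

lemma trig_sum_polynomial_sin_map:
  fixes p :: "'a::euclidean_space \<Rightarrow> real"
  assumes "real_polynomial_function p"
  shows "trig_sum (\<lambda>x. complex_of_real (p (sin_map L x)))"
  using assms
proof induction
  case (linear f)
  interpret bounded_linear f by fact
  have "complex_of_real (f (sin_map L x)) = (\<Sum>b\<in>Basis. complex_of_real (f b) * complex_of_real (sin ((b /\<^sub>R L) \<bullet> x)))" for x
    by (simp add: sin_map_def sum scaleR mult.commute)
  then show ?case by (simp only:) (intro trig_sum_sum trig_sum.scale trig_sum_sin)
qed (auto intro: trig_sum_const trig_sum.add trig_sum_mult)

lemma sin_map_mem_cbox: "sin_map L x \<in> cbox (- One) One"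
  by (auto simp: mem_box sin_map_def inner_sum_left_Basis abs_le_iff)

lemma continuous_on_sin_map: "continuous_on A (sin_map L)"
  unfolding sin_map_def by (intro continuous_intros)

lemma scaleR_sin_map_tendsto: "(\<lambda>n. real (Suc n) *\<^sub>R sin_map (real (Suc n)) x) \<longlonglongrightarrow> x"
proof -
  have lim: "(\<lambda>n. real (Suc n) * sin (y / real (Suc n))) \<longlonglongrightarrow> y" for y :: real
    by real_asymp
  have "(\<lambda>n. \<Sum>b\<in>Basis. (real (Suc n) * sin ((b \<bullet> x) / real (Suc n))) *\<^sub>R b) \<longlonglongrightarrow> (\<Sum>b\<in>Basis. (b \<bullet> x) *\<^sub>R b)"
    by (intro tendsto_intros lim)
  then show ?thesis
    by (simp add: sin_map_def scaleR_sum_right euclidean_representation inner_commute[of _ x] divide_inverse mult.commute)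
qed

lemma trig_sum_continuous: "trig_sum f \<Longrightarrow> continuous_on UNIV f"
  by (induction rule: trig_sum.induct) (auto intro!: continuous_intros simp: cis_conv_exp)

lemma trig_sum_integrable:
  assumes "trig_sum f" "finite_measure M" "sets M = sets borel"
  shows "integrable M f"
  using assms(1)
proof induction
  case (cis u)
  have "(\<lambda>x. cis (u \<bullet> x)) \<in> borel_measurable M"
    unfolding measurable_cong_sets[OF assms(3) refl]
    by (intro borel_measurable_continuous_onI trig_sum_continuous trig_sum.cis)
  then show ?case by (intro finite_measure.integrable_const_bound[OF assms(2), of _ 1]) auto
qed auto

section \<open>From equal characteristic functions to equal measures\<close>

context
  fixes M N :: "'a::euclidean_space measure"
  assumes M: "prob_space M" "sets M = sets borel"
    and N: "prob_space N" "sets N = sets borel"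
    and cf: "\<And>u. (\<integral>x. cis (u \<bullet> x) \<partial>M) = (\<integral>x. cis (u \<bullet> x) \<partial>N)"
begin

lemma trig_sum_integral_eq: "trig_sum f \<Longrightarrow> (\<integral>x. f x \<partial>M) = (\<integral>x. f x \<partial>N)"
proof (induction rule: trig_sum.induct)
  case (add f g)
  then show ?case using M N by (simp add: trig_sum_integrable prob_space.finite_measure)
qed (use cf in auto)

lemma bounded_continuous_integral_eq:
  fixes h :: "'a \<Rightarrow> real"
  assumes cont: "continuous_on UNIV h" and bd: "\<And>x. \<bar>h x\<bar> \<le> K"
  shows "(\<integral>x. h x \<partial>M) = (\<integral>x. h x \<partial>N)"
proof -
  have cont2: "continuous_on UNIV (\<lambda>x. h (L *\<^sub>R sin_map L x))" for L
    by (intro continuous_on_compose2[OF cont] continuous_intros continuous_on_sin_map) auto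
  have eqL: "(\<integral>x. h (L *\<^sub>R sin_map L x) \<partial>M) = (\<integral>x. h (L *\<^sub>R sin_map L x) \<partial>N)" for L
  proof (rule ccontr)
    let ?I = "\<lambda>M. (\<integral>x. h (L *\<^sub>R sin_map L x) \<partial>M)"
    assume "?I M \<noteq> ?I N"
    \<comment> \<open>A third of the gap: passing to the polynomial costs at most \<open>?e\<close>
      under either measure, and the polynomial has equal integrals, so the gap \<open>3 * ?e\<close>
      would be at most \<open>2 * ?e\<close>.\<close>
    then have e: "\<bar>?I M - ?I N\<bar> / 3 > 0" (is "?e > 0") by simp
    have "continuous_on (cbox (-One) One) (\<lambda>y. h (L *\<^sub>R y))"
      by (intro continuous_on_compose2[OF cont] continuous_intros) auto
    from Stone_Weierstrass_real_polynomial_function[OF compact_cbox this e]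
    obtain p where p: "real_polynomial_function p"
      "\<And>y. y \<in> cbox (-One) One \<Longrightarrow> \<bar>h (L *\<^sub>R y) - p y\<bar> < ?e" by blast
    have tp: "trig_sum (\<lambda>x. complex_of_real (p (sin_map L x)))"
      by (rule trig_sum_polynomial_sin_map[OF p(1)])
    have close: "\<bar>?I P - (\<integral>x. p (sin_map L x) \<partial>P)\<bar> \<le> ?e" if P: "prob_space P" "sets P = sets borel" for P :: "'a measure"
    proof -
      interpret P: prob_space P by fact
      have i1: "integrable P (\<lambda>x. h (L *\<^sub>R sin_map L x))"
        using bd cont2 by (intro P.integrable_const_bound[of _ K])
          (auto simp: measurable_cong_sets[OF P(2) refl] intro: borel_measurable_continuous_onI)
      have i2: "integrable P (\<lambda>x. p (sin_map L x))"
        using integrable_Re[OF trig_sum_integrable[OF tp P.finite_measure_axioms P(2)]] by simp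
      have "\<bar>?I P - (\<integral>x. p (sin_map L x) \<partial>P)\<bar> = \<bar>\<integral>x. h (L *\<^sub>R sin_map L x) - p (sin_map L x) \<partial>P\<bar>"
        using i1 i2 by simp
      also have "\<dots> \<le> (\<integral>x. \<bar>h (L *\<^sub>R sin_map L x) - p (sin_map L x)\<bar> \<partial>P)"
        by (rule integral_abs_bound)
      also have "\<dots> \<le> (\<integral>x. ?e \<partial>P)"
        using i1 i2 p(2)[OF sin_map_mem_cbox] by (intro integral_mono) (auto intro: less_imp_le)
      also have "\<dots> = ?e" by (simp add: P.prob_space)
      finally show ?thesis .
    qed
    have "complex_of_real (\<integral>x. p (sin_map L x) \<partial>M) = complex_of_real (\<integral>x. p (sin_map L x) \<partial>N)"
      using trig_sum_integral_eq[OF tp] by simp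
    then have "(\<integral>x. p (sin_map L x) \<partial>M) = (\<integral>x. p (sin_map L x) \<partial>N)" by simp
    then have "\<bar>?I N - (\<integral>x. p (sin_map L x) \<partial>M)\<bar> \<le> ?e" using close[OF N] by simp
    moreover have "\<bar>?I M - ?I N\<bar> \<le> \<bar>?I M - q\<bar> + \<bar>?I N - q\<bar>" for q by linarith
    ultimately have "\<bar>?I M - ?I N\<bar> \<le> ?e + ?e"
      by (rule order_trans[rotated, OF add_mono[OF close[OF M]]])
    then show False using e by simp
  qed
  have lim: "(\<lambda>n. \<integral>x. h (real (Suc n) *\<^sub>R sin_map (real (Suc n)) x) \<partial>P) \<longlonglongrightarrow> (\<integral>x. h x \<partial>P)"
    if P: "prob_space P" "sets P = sets borel" for P :: "'a measure"
  proof (rule integral_dominated_convergence[where w="\<lambda>x. K"])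
    interpret P: prob_space P by fact
    show "integrable P (\<lambda>x. K)" by simp
    show "AE x in P. (\<lambda>n. h (real (Suc n) *\<^sub>R sin_map (real (Suc n)) x)) \<longlonglongrightarrow> h x"
      by (intro AE_I2 continuous_on_tendsto_compose[OF cont] scaleR_sin_map_tendsto) auto
  qed (use bd cont cont2 in \<open>auto simp: measurable_cong_sets[OF P(2) refl] intro: borel_measurable_continuous_onI\<close>)
  show ?thesis
    using LIMSEQ_unique[OF lim[OF M]] lim[OF N] eqL by simp
qed

text \<open>Closed sets are an intersection-stable generator, and the indicator of a nonempty closed
  set is a pointwise limit of bounded continuous functions of the distance to it.\<close>

lemma measure_eqI_characteristic: "M = N"
proof (rule measure_eqI_generator_eq[where \<Omega>=UNIV and E="Collect closed" and A="\<lambda>_. UNIV"])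
  have meas: "measure P F = lim (\<lambda>n. \<integral>x. max 0 (1 - real n * infdist x F) \<partial>P)"
    if P: "prob_space P" "sets P = sets borel" and F: "closed F" "F \<noteq> {}" for P :: "'a measure" and F
  proof -
    interpret P: prob_space P by fact
    have "(\<lambda>n. \<integral>x. max 0 (1 - real n * infdist x F) \<partial>P) \<longlonglongrightarrow> (\<integral>x. indicator F x \<partial>P)"
    proof (rule integral_dominated_convergence[where w="\<lambda>x. 1"])
      show "AE x in P. (\<lambda>n. max 0 (1 - real n * infdist x F)) \<longlonglongrightarrow> indicator F x"
      proof (rule AE_I2)
        fix x
        show "(\<lambda>n. max 0 (1 - real n * infdist x F)) \<longlonglongrightarrow> indicator F x"
        proof (cases "x \<in> F")
          case False
          then have d: "infdist x F > 0" using F by (simp add: infdist_pos_not_in_closed)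
          obtain k where k: "1 < real k * infdist x F" using ex_less_of_nat_mult[OF d] by blast
          have "max 0 (1 - real n * infdist x F) = 0" if "n \<ge> k" for n
          proof -
            have "real k * infdist x F \<le> real n * infdist x F" using that d by simp
            then show ?thesis using k by simp
          qed
          then show ?thesis using False
            by (intro tendsto_eventually) (auto simp: eventually_sequentially)
        qed simp
      qed
      show "AE x in P. norm (max 0 (1 - real n * infdist x F)) \<le> 1" for n
        by (simp add: infdist_nonneg)
    qed (use F in \<open>auto simp: measurable_cong_sets[OF P(2) refl]
          intro!: borel_measurable_continuous_onI continuous_intros\<close>)
    moreover have "(\<integral>x. indicator F x \<partial>P) = measure P F" using F by (simp add: P)
    ultimately show ?thesis by (simp add: limI)
  qed
  show "emeasure M F = emeasure N F" if "F \<in> Collect closed" for F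
  \<comment> \<open>By convention \<open>infdist x {} = 0\<close>, so the approximating functions
    would be constantly one for the empty set.\<close>
  proof (cases "F = {}")
    case False
    have "(\<integral>x. max 0 (1 - real n * infdist x F) \<partial>M) = (\<integral>x. max 0 (1 - real n * infdist x F) \<partial>N)" for n
      by (rule bounded_continuous_integral_eq[where K=1])
         (auto intro!: continuous_intros simp: infdist_nonneg)
    then have "measure M F = measure N F" using meas[OF M] meas[OF N] False that by simp
    then show ?thesis using M N
      by (simp add: finite_measure.emeasure_eq_measure prob_space.finite_measure)
  qed simp
  show "emeasure M UNIV \<noteq> \<infinity>" using M
    by (simp add: finite_measure.emeasure_finite prob_space.finite_measure)
qed (use M N in \<open>auto simp: Int_stable_def borel_eq_closed\<close>)

end

lemma distr_eqI_characteristic: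
  fixes X Y :: "'b \<Rightarrow> 'a::euclidean_space"
  assumes "prob_space P" "X \<in> borel_measurable P" "Y \<in> borel_measurable P"
    and "\<And>u. (\<integral>\<omega>. cis (u \<bullet> X \<omega>) \<partial>P) = (\<integral>\<omega>. cis (u \<bullet> Y \<omega>) \<partial>P)"
  shows "distr P borel X = distr P borel Y"
proof (rule measure_eqI_characteristic)
  have "(\<lambda>x. cis (u \<bullet> x)) \<in> borel_measurable borel" for u :: 'a
    by (intro borel_measurable_continuous_onI trig_sum_continuous trig_sum.cis)
  then show "(\<integral>x. cis (u \<bullet> x) \<partial>distr P borel X) = (\<integral>x. cis (u \<bullet> x) \<partial>distr P borel Y)" for u
    using assms by (simp add: integral_distr)
qed (use assms in \<open>auto intro: prob_space.prob_space_distr\<close>)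

section \<open>Fundamental matrices and partitions\<close>

lemma has_vector_derivative_matrix_vector_mult_const:
  fixes X :: "real \<Rightarrow> real^'n^'m"
  assumes "(X has_vector_derivative X') F"
  shows "((\<lambda>t. X t *v x) has_vector_derivative (X' *v x)) F"
  using bounded_linear.has_vector_derivative[OF bounded_bilinear.bounded_linear_left[OF bounded_bilinear_matrix_vector_mult] assms] .

lemma continuous_matrix_form_bound:
  fixes C :: "real \<Rightarrow> real^'n^'n"
  assumes "continuous_on {0..T} C"
  obtains K where "K \<ge> 0" "\<And>s x. s \<in> {0..T} \<Longrightarrow> \<bar>x \<bullet> (C s *v x)\<bar> \<le> K * (norm x)\<^sup>2"
proof -
  obtain B where B: "B > 0" "\<And>A x. norm ((A :: real^'n^'n) *v x) \<le> norm A * norm x * B"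
    using bounded_bilinear.pos_bounded[OF bounded_bilinear_matrix_vector_mult] by blast
  have "bounded (C ` {0..T})" using assms compact_continuous_image compact_imp_bounded by blast
  then obtain L where L: "L > 0" "\<And>s. s \<in> {0..T} \<Longrightarrow> norm (C s) \<le> L"
    by (auto simp: bounded_pos)
  have "\<bar>x \<bullet> (C s *v x)\<bar> \<le> (L * B) * (norm x)\<^sup>2" if "s \<in> {0..T}" for s x
  proof -
    have "\<bar>x \<bullet> (C s *v x)\<bar> \<le> norm x * norm (C s *v x)" by (rule Cauchy_Schwarz_ineq2)
    also have "\<dots> \<le> norm x * (L * norm x * B)"
      using B L(2)[OF that] by (intro mult_left_mono order_trans[OF B(2)] mult_right_mono) auto
    finally show ?thesis by (simp add: power2_eq_square mult_ac)
  qed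
  then show ?thesis using that[of "L * B"] L B by simp
qed

text \<open>The derivative of the squared norm lies within \<open>2 * K\<close> times the squared
  norm, up to sign, so the factors \<open>exp (2 * K * r)\<close> and
  \<open>exp (- 2 * K * r)\<close> make it increasing and decreasing. The first bound excludes decay
  to zero and gives invertibility of the fundamental matrix; the second gives uniqueness.\<close>

lemma linear_ode_energy_bounds:
  fixes y :: "real \<Rightarrow> real^'n"
  assumes y: "\<And>t. t \<ge> 0 \<Longrightarrow> (y has_vector_derivative (C t *v y t)) (at t within {0..})"
    and K: "\<And>s x. s \<in> {0..T} \<Longrightarrow> \<bar>x \<bullet> (C s *v x)\<bar> \<le> K * (norm x)\<^sup>2"
    and st: "0 \<le> s" "s \<le> t" "t \<le> T"
  shows "(norm (y s))\<^sup>2 \<le> (norm (y t))\<^sup>2 * exp (2 * K * (t - s))"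
    and "(norm (y t))\<^sup>2 \<le> (norm (y s))\<^sup>2 * exp (2 * K * (t - s))"
proof -
  let ?g = "\<lambda>L r. (y r \<bullet> y r) * exp (2 * L * r)"
  have ycont: "continuous_on {0..} y"
    using y by (auto simp: continuous_on_eq_continuous_within intro: has_vector_derivative_continuous)
  have cont: "continuous_on {s..t} (?g L)" for L
    using st by (intro continuous_intros continuous_on_subset[OF ycont]) auto
  have deriv: "(?g L has_real_derivative (2 * (y r \<bullet> (C r *v y r)) + 2 * L * (y r \<bullet> y r)) * exp (2 * L * r)) (at r)"
    if "s < r" "r < t" for r L
  proof -
    have "r \<in> interior {0..}" using that st by simp
    then have at: "at r within {0..} = at r" by (rule at_within_interior)
    have yd: "(y has_vector_derivative (C r *v y r)) (at r)" using y[of r] that st at by simp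
    have "((\<lambda>r. y r \<bullet> y r) has_vector_derivative (y r \<bullet> (C r *v y r) + (C r *v y r) \<bullet> y r)) (at r)"
      by (rule bounded_bilinear.has_vector_derivative[OF bounded_bilinear_inner yd yd])
    then have "((\<lambda>r. y r \<bullet> y r) has_real_derivative 2 * (y r \<bullet> (C r *v y r))) (at r)"
      by (simp add: has_real_derivative_iff_has_vector_derivative inner_commute)
    then show ?thesis
      by (auto intro!: derivative_eq_intros simp: algebra_simps)
  qed
  have abs: "\<bar>y r \<bullet> (C r *v y r)\<bar> \<le> K * (y r \<bullet> y r)" if "s < r" "r < t" for r
    using K[of r "y r"] that st by (simp add: dot_square_norm)
  have "?g K s \<le> ?g K t"
  proof (rule DERIV_nonneg_imp_increasing_open[OF st(2) _ cont])
    fix r assume r: "s < r" "r < t"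
    have "0 \<le> (2 * (y r \<bullet> (C r *v y r)) + 2 * K * (y r \<bullet> y r)) * exp (2 * K * r)"
      using abs[OF r] by (intro mult_nonneg_nonneg) auto
    then show "\<exists>z. (?g K has_real_derivative z) (at r) \<and> 0 \<le> z" using deriv[OF r] by blast
  qed
  then show "(norm (y s))\<^sup>2 \<le> (norm (y t))\<^sup>2 * exp (2 * K * (t - s))"
    by (simp add: dot_square_norm right_diff_distrib exp_diff field_simps)
  have "?g (-K) t \<le> ?g (-K) s"
  proof (rule DERIV_nonpos_imp_decreasing_open[OF st(2) _ cont])
    fix r assume r: "s < r" "r < t"
    have "(2 * (y r \<bullet> (C r *v y r)) + 2 * (- K) * (y r \<bullet> y r)) * exp (2 * (- K) * r) \<le> 0"
      using abs[OF r] by (intro mult_nonpos_nonneg) auto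
    then show "\<exists>z. (?g (-K) has_real_derivative z) (at r) \<and> z \<le> 0" using deriv[OF r, of "-K"] by blast
  qed
  then show "(norm (y t))\<^sup>2 \<le> (norm (y s))\<^sup>2 * exp (2 * K * (t - s))"
    by (simp add: dot_square_norm right_diff_distrib exp_diff exp_minus field_simps)
qed

lemma linear_ode_unique_zero:
  fixes y :: "real \<Rightarrow> real^'n"
  assumes C: "continuous_on {0..} C"
    and y: "\<And>t. t \<ge> 0 \<Longrightarrow> (y has_vector_derivative (C t *v y t)) (at t within {0..})"
    and y0: "y 0 = 0" and t: "t \<ge> 0"
  shows "y t = 0"
proof -
  have "continuous_on {0..t} C" by (rule continuous_on_subset[OF C]) auto
  then obtain K where K: "\<And>s x. s \<in> {0..t} \<Longrightarrow> \<bar>x \<bullet> (C s *v x)\<bar> \<le> K * (norm x)\<^sup>2"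
    using continuous_matrix_form_bound by metis
  show ?thesis using linear_ode_energy_bounds(2)[OF y K order_refl t order_refl] t y0 by simp
qed

lemma matrix_inv_inverse:
  fixes A :: "real^'n^'n" assumes "invertible A"
  shows "A ** matrix_inv A = mat 1" "matrix_inv A ** A = mat 1"
  using someI_ex[OF assms[unfolded invertible_def]] by (auto simp: matrix_inv_def)

section \<open>The fundamental matrix and its inverse\<close>

locale fundamental_matrix =
  fixes C \<Phi> :: "real \<Rightarrow> real^'n^'n"
  assumes cont_C: "continuous_on {0..} C"
    and deriv: "\<And>t. t \<ge> 0 \<Longrightarrow> (\<Phi> has_vector_derivative (C t ** \<Phi> t)) (at t within {0..})"
    and init: "\<Phi> 0 = mat 1"
begin

abbreviation \<Psi> :: "real \<Rightarrow> real^'n^'n" where "\<Psi> t \<equiv> matrix_inv (\<Phi> t)"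

lemma cont_\<Phi>: "continuous_on {0..} \<Phi>"
  using deriv by (auto simp: continuous_on_eq_continuous_within intro: has_vector_derivative_continuous)

lemma deriv_vec: "t \<ge> 0 \<Longrightarrow> ((\<lambda>t. \<Phi> t *v x) has_vector_derivative (C t *v (\<Phi> t *v x))) (at t within {0..})"
  using has_vector_derivative_matrix_vector_mult_const[OF deriv] by (simp add: matrix_vector_mul_assoc)

text \<open>Injectivity with a constant uniform on a compact interval. It yields invertibility, and
  applied to vectors \<open>\<Psi> s *v y\<close> it bounds the inverses uniformly.\<close>

lemma norm_lower_bound:
  obtains L where "\<And>t x. t \<in> {0..T} \<Longrightarrow> norm x \<le> L * norm (\<Phi> t *v x)"
proof -
  have "continuous_on {0..T} C" by (rule continuous_on_subset[OF cont_C]) auto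
  then obtain K where K: "K \<ge> 0" "\<And>s x. s \<in> {0..T} \<Longrightarrow> \<bar>x \<bullet> (C s *v x)\<bar> \<le> K * (norm x)\<^sup>2"
    using continuous_matrix_form_bound by metis
  have "norm x \<le> exp (K * T) * norm (\<Phi> t *v x)" if t: "t \<in> {0..T}" for t x
  proof -
    have "(norm (\<Phi> 0 *v x))\<^sup>2 \<le> (norm (\<Phi> t *v x))\<^sup>2 * exp (2 * K * (t - 0))"
      using t by (intro linear_ode_energy_bounds(1)[OF deriv_vec K(2)]) auto
    also have "\<dots> \<le> (norm (\<Phi> t *v x))\<^sup>2 * exp (2 * K * T)"
      using t K(1) by (intro mult_left_mono) (auto intro: mult_left_mono)
    also have "\<dots> = (exp (K * T) * norm (\<Phi> t *v x))\<^sup>2"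
      by (simp add: power_mult_distrib exp_double[symmetric] mult_ac)
    finally show ?thesis using init by (simp add: power2_le_iff_abs_le)
  qed
  then show ?thesis using that by blast
qed

lemma invertible_\<Phi>: assumes "t \<ge> 0" shows "invertible (\<Phi> t)"
proof -
  obtain L where L: "\<And>s x. s \<in> {0..t} \<Longrightarrow> norm x \<le> L * norm (\<Phi> s *v x)" using norm_lower_bound by metis
  have "x = 0" if "\<Phi> t *v x = 0" for x using L[of t x] assms that by simp
  then show ?thesis by (simp add: invertible_left_inverse matrix_left_invertible_ker)
qed

lemma \<Phi>\<Psi>: "t \<ge> 0 \<Longrightarrow> \<Phi> t ** \<Psi> t = mat 1" and \<Psi>\<Phi>: "t \<ge> 0 \<Longrightarrow> \<Psi> t ** \<Phi> t = mat 1"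
  using invertible_\<Phi> matrix_inv_inverse by auto

lemma \<Psi>_diff:
  assumes "s \<ge> 0" "t \<ge> 0" shows "\<Psi> s - \<Psi> t = - (\<Psi> s ** (\<Phi> s - \<Phi> t) ** \<Psi> t)"
proof -
  have "\<Psi> s ** (\<Phi> s - \<Phi> t) ** \<Psi> t = \<Psi> s ** \<Phi> s ** \<Psi> t - \<Psi> s ** (\<Phi> t ** \<Psi> t)"
    by (simp add: bounded_bilinear.diff_left[OF bounded_bilinear_matrix_mult]
      bounded_bilinear.diff_right[OF bounded_bilinear_matrix_mult] matrix_mul_assoc)
  then show ?thesis using assms by (simp add: \<Phi>\<Psi> \<Psi>\<Phi>)
qed

text \<open>By \<open>\<Psi>_diff\<close>, the change of \<open>\<Psi>\<close> is a uniformly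
  bounded \<open>\<Psi> s\<close> applied to something that vanishes with
  \<open>\<Phi> s - \<Phi> t\<close>.\<close>

lemma cont_\<Psi>: "continuous_on {0..} \<Psi>"
  unfolding continuous_on_def
proof
  fix t :: real assume t: "t \<in> {0..}"
  \<comment> \<open>The horizon \<open>t + 1\<close> leaves room for times \<open>s\<close> beyond
    \<open>t\<close>.\<close>
  obtain L where L: "\<And>s x. s \<in> {0..t+1} \<Longrightarrow> norm x \<le> L * norm (\<Phi> s *v x)" using norm_lower_bound by metis
  have lim: "((\<lambda>s. \<Psi> s *v x) \<longlongrightarrow> \<Psi> t *v x) (at t within {0..})" for x
  proof (rule Lim_null[THEN iffD2], rule Lim_null_comparison)
    show "((\<lambda>s. L * norm ((\<Phi> s - \<Phi> t) *v (\<Psi> t *v x))) \<longlongrightarrow> 0) (at t within {0..})"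
    proof -
      have "(\<Phi> \<longlongrightarrow> \<Phi> t) (at t within {0..})" using cont_\<Phi> t by (simp add: continuous_on_def)
      then have "((\<lambda>s. L * norm ((\<Phi> s - \<Phi> t) *v (\<Psi> t *v x))) \<longlongrightarrow> L * norm ((\<Phi> t - \<Phi> t) *v (\<Psi> t *v x))) (at t within {0..})"
        by (intro tendsto_intros)
      then show ?thesis by simp
    qed
    have "\<forall>\<^sub>F s in at t within {0..}. s < t + 1" by (rule order_tendstoD[OF tendsto_ident_at]) simp
    moreover have "\<forall>\<^sub>F s in at t within {0..}. s \<in> {0..}" by (simp add: eventually_at_filter)
    ultimately show "\<forall>\<^sub>F s in at t within {0..}. norm (\<Psi> s *v x - \<Psi> t *v x) \<le> L * norm ((\<Phi> s - \<Phi> t) *v (\<Psi> t *v x))"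
    proof eventually_elim
      case (elim s)
      have "\<Psi> s *v x - \<Psi> t *v x = - (\<Psi> s *v ((\<Phi> s - \<Phi> t) *v (\<Psi> t *v x)))"
        using \<Psi>_diff[of s t] elim t
        by (simp add: matrix_vector_mult_diff_rdistrib[symmetric] matrix_vector_mul_assoc
            matrix_mul_assoc bounded_bilinear.minus_left[OF bounded_bilinear_matrix_vector_mult] del: matrix_vector_mult_diff_rdistrib)
      then show ?case using L[of s "\<Psi> s *v ((\<Phi> s - \<Phi> t) *v (\<Psi> t *v x))"] elim
        by (simp add: matrix_vector_mul_assoc[of "\<Phi> s" "\<Psi> s"] \<Phi>\<Psi>)
    qed
  qed
  have comp: "\<Psi> s $ i $ j = (\<Psi> s *v axis j 1) $ i" for s i j
    by (simp add: matrix_vector_mult_basis column_def)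
  show "(\<Psi> \<longlongrightarrow> \<Psi> t) (at t within {0..})"
    by (intro vec_tendstoI) (unfold comp, intro tendsto_intros lim)
qed

lemma \<Phi>_increment:
  assumes "0 \<le> a" "a \<le> b"
  shows "((\<lambda>s. C s ** \<Phi> s) has_integral (\<Phi> b - \<Phi> a)) {a..b}"
  using assms by (intro fundamental_theorem_of_calculus has_vector_derivative_within_subset[OF deriv]) auto

text \<open>Floquet's relation: periodicity of \<open>C\<close> makes the shifted solution solve the
  same equation, and at time zero both sides are \<open>\<Phi> \<theta>\<close>, so uniqueness
  applies to each image vector.\<close>

lemma \<Phi>_shift:
  assumes per: "\<And>t. t \<ge> 0 \<Longrightarrow> C (t + \<theta>) = C t" and \<theta>: "\<theta> \<ge> 0" and t: "t \<ge> 0"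
  shows "\<Phi> (t + \<theta>) = \<Phi> t ** \<Phi> \<theta>"
proof -
  have "\<Phi> (t + \<theta>) *v x - \<Phi> t *v (\<Phi> \<theta> *v x) = 0" for x
  proof (rule linear_ode_unique_zero[OF cont_C _ _ t])
    show "\<Phi> (0 + \<theta>) *v x - \<Phi> 0 *v (\<Phi> \<theta> *v x) = 0" by (simp add: init)
    fix s :: real assume s: "s \<ge> 0"
    have "((\<lambda>s. s + \<theta>) has_vector_derivative 1) (at s within {0..})"
      by (auto intro!: derivative_eq_intros)
    moreover have "((\<lambda>t. \<Phi> t *v x) has_vector_derivative (C (s + \<theta>) *v (\<Phi> (s + \<theta>) *v x))) (at (s + \<theta>) within ((\<lambda>s. s + \<theta>) ` {0..}))"
      using s \<theta> by (intro has_vector_derivative_within_subset[OF deriv_vec]) auto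
    ultimately have "((\<lambda>s. \<Phi> (s + \<theta>) *v x) has_vector_derivative (C s *v (\<Phi> (s + \<theta>) *v x))) (at s within {0..})"
      using vector_diff_chain_within[of "\<lambda>s. s + \<theta>" 1 s "{0..}" "\<lambda>t. \<Phi> t *v x"] per[OF s]
      by (simp add: o_def)
    from has_vector_derivative_diff[OF this deriv_vec[OF s]]
    show "((\<lambda>t. \<Phi> (t + \<theta>) *v x - \<Phi> t *v (\<Phi> \<theta> *v x)) has_vector_derivative
           C s *v (\<Phi> (s + \<theta>) *v x - \<Phi> s *v (\<Phi> \<theta> *v x))) (at s within {0..})"
      by (simp add: matrix_vector_mult_diff_distrib)
  qed
  then show ?thesis by (simp add: matrix_eq matrix_vector_mul_assoc)
qed

end

section \<open>Sums over equal cells\<close>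

lemma integral_equal_cells:
  fixes f :: "real \<Rightarrow> 'a::euclidean_space"
  assumes "continuous_on {0..T} f" "T \<ge> 0" "n > 0"
  shows "integral {0..T} f = (\<Sum>i<n. integral {real i * T / n..real (Suc i) * T / n} f)"
proof -
  have "k \<le> n \<Longrightarrow> integral {0..real k * T / n} f = (\<Sum>i<k. integral {real i * T / n..real (Suc i) * T / n} f)" for k
  proof (induction k)
    case (Suc k)
    have le: "real (Suc k) * T / n \<le> T" using Suc.prems assms
      by (simp add: divide_le_eq mult.commute mult_left_mono del: of_nat_Suc)
    have "f integrable_on {0..real (Suc k) * T / n}"
      by (intro integrable_continuous_interval continuous_on_subset[OF assms(1)]) (use le in auto)
    then have "integral {0..real (Suc k) * T / n} f =
        integral {0..real k * T / n} f + integral {real k * T / n..real (Suc k) * T / n} f"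
      using assms by (intro Henstock_Kurzweil_Integration.integral_combine[symmetric])
        (auto intro!: divide_right_mono mult_right_mono)
    then show ?case using Suc by simp
  qed simp
  from this[of n] show ?thesis using assms by simp
qed

lemma grid_cell_bounds:
  assumes "i < n" "T \<ge> 0" shows "0 \<le> real i * T / n" "real i * T / n \<le> real (Suc i) * T / n" "real (Suc i) * T / n \<le> T"
    "real (Suc i) * T / n - real i * T / n = T / n"
proof -
  show "real (Suc i) * T / n \<le> T" using assms
    by (simp add: divide_le_eq mult.commute mult_left_mono del: of_nat_Suc)
  show "real (Suc i) * T / n - real i * T / n = T / n"
    by (simp add: diff_divide_distrib[symmetric] algebra_simps)
qed (use assms in \<open>auto intro!: divide_right_mono mult_right_mono\<close>)

text \<open>A common tool for the variance limit and the pathwise limit. The tags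
  \<open>a i\<close>, \<open>b i\<close> are close to every point of their cell, so uniform
  continuity keeps the integrand below \<open>e / T\<close> there, and the cells have total length
  \<open>T\<close>.\<close>

lemma sum_cell_integrals_small:
  fixes F :: "real \<times> real \<times> real \<Rightarrow> 'a::euclidean_space"
  assumes cont: "continuous_on ({0..T} \<times> {0..T} \<times> {0..T}) F"
    and diag: "\<And>s. s \<in> {0..T} \<Longrightarrow> F (s, s, s) = 0" and T: "T > 0" and e: "e > 0"
  obtains \<delta> where "\<delta> > 0"
    "\<And>n a b. n > 0 \<Longrightarrow>
       (\<And>i s. i < n \<Longrightarrow> s \<in> {real i * T / n..real (Suc i) * T / n} \<Longrightarrow>
          a i \<in> {0..T} \<and> b i \<in> {0..T} \<and> \<bar>a i - s\<bar> < \<delta> \<and> \<bar>b i - s\<bar> < \<delta>) \<Longrightarrow>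
       norm (\<Sum>i<n. integral {real i * T / n..real (Suc i) * T / n} (\<lambda>s. F (a i, s, b i))) \<le> e"
proof -
  have "uniformly_continuous_on ({0..T} \<times> {0..T} \<times> {0..T}) F"
    by (intro compact_uniformly_continuous cont compact_Times compact_Icc)
  then obtain d where d: "d > 0" and F: "\<And>x y. x \<in> {0..T} \<times> {0..T} \<times> {0..T} \<Longrightarrow> y \<in> {0..T} \<times> {0..T} \<times> {0..T} \<Longrightarrow>
      dist y x < d \<Longrightarrow> dist (F y) (F x) < e / T"
    unfolding uniformly_continuous_on_def using e T by (metis divide_pos_pos)
  have small: "norm (F (a, s, b)) \<le> e / T"
    if "a \<in> {0..T}" "b \<in> {0..T}" "s \<in> {0..T}" "\<bar>a - s\<bar> < d / 2" "\<bar>b - s\<bar> < d / 2" for a s b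
  proof -
    have "dist (a, s, b) (s, s, s) = norm (a - s, 0::real, b - s)" by (simp add: dist_norm)
    also have "\<dots> \<le> norm (a - s) + (norm (0::real) + norm (b - s))"
      by (rule order_trans[OF norm_Pair_le add_left_mono[OF norm_Pair_le]])
    also have "\<dots> < d" using that by simp
    finally show ?thesis using F[of "(s,s,s)" "(a,s,b)"] diag that by simp
  qed
  show ?thesis
  \<comment> \<open>Halved because both tags may be off, and the distance of
    \<open>(a, s, b)\<close> to the diagonal point is bounded by the sum of the two errors.\<close>
  proof (rule that[of "d / 2"])
    fix n :: nat and a b :: "nat \<Rightarrow> real"
    assume n: "n > 0" and ab: "\<And>i s. i < n \<Longrightarrow> s \<in> {real i * T / n..real (Suc i) * T / n} \<Longrightarrow>
          a i \<in> {0..T} \<and> b i \<in> {0..T} \<and> \<bar>a i - s\<bar> < d / 2 \<and> \<bar>b i - s\<bar> < d / 2"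
    have "norm (\<Sum>i<n. integral {real i * T / n..real (Suc i) * T / n} (\<lambda>s. F (a i, s, b i))) \<le> (\<Sum>i<n. e / T * (T / n))"
    proof (rule sum_norm_le)
      fix i assume "i \<in> {..<n}"
      then have i: "i < n" by simp
      note g = grid_cell_bounds[OF i less_imp_le[OF T]]
      let ?c = "{real i * T / n..real (Suc i) * T / n}"
      have cs: "s \<in> {0..T}" if "s \<in> ?c" for s
        using that g(1,3) by (simp only: atLeastAtMost_iff) linarith
      have ai: "a i \<in> {0..T}" "b i \<in> {0..T}" using ab[OF i, of "real i * T / n"] g by auto
      have "continuous_on ?c (\<lambda>s. F (a i, s, b i))"
        by (rule continuous_on_compose2[OF cont]) (use cs ai in \<open>auto intro!: continuous_intros\<close>)
      moreover have "norm (F (a i, s, b i)) \<le> e / T" if "s \<in> ?c" for s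
        using small ai cs[OF that] ab[OF i that] by blast
      ultimately have "norm (integral ?c (\<lambda>s. F (a i, s, b i))) \<le> (e / T) * (real (Suc i) * T / n - real i * T / n)"
        by (intro integral_bound g(2))
      then show "norm (integral ?c (\<lambda>s. F (a i, s, b i))) \<le> e / T * (T / n)" by (simp only: g(4))
    qed
    also have "\<dots> = e" using n T by simp
    finally show "norm (\<Sum>i<n. integral {real i * T / n..real (Suc i) * T / n} (\<lambda>s. F (a i, s, b i))) \<le> e" .
  qed (use d in simp)
qed

section \<open>Convergence in probability and Brownian sums\<close>

lemma borel_measurable_matrix_vector_mult [measurable (raw)]:
  fixes f :: "'a \<Rightarrow> real^'n" and A :: "real^'n^'m"
  assumes "f \<in> borel_measurable M" shows "(\<lambda>x. A *v f x) \<in> borel_measurable M"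
  using assms by (rule measurable_compose) (intro borel_measurable_continuous_onI continuous_intros)

lemma borel_measurable_cis [measurable]: "cis \<in> borel_measurable borel"
  by (intro borel_measurable_continuous_onI) (auto simp: cis_conv_exp intro!: continuous_intros)

text \<open>The truncation \<open>min 1\<close> matches the expectations in
  \<open>vanishes_in_prob\<close>; the factor 2 is the diameter of the unit circle.\<close>

lemma norm_cis_diff_le: "norm (cis a - cis b) \<le> 2 * min 1 \<bar>a - b\<bar>"
proof -
  have "cis a - cis b = cis b * (cis (a - b) - 1)" by (simp add: right_diff_distrib cis_mult)
  then have "norm (cis a - cis b) = norm (cis (a - b) - 1)" by (simp add: norm_mult)
  also have "\<dots> \<le> \<bar>a - b\<bar>"
    using iexp_approx1[of "a - b" 0] by (simp add: cis_conv_exp mult.commute)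
  finally have "norm (cis a - cis b) \<le> \<bar>a - b\<bar>" .
  moreover have "norm (cis a - cis b) \<le> norm (cis a) + norm (cis b)" by (rule norm_triangle_ineq4)
  ultimately show ?thesis using abs_ge_zero[of "a - b"] by (auto simp: min_def simp del: abs_ge_zero)
qed

context prob_space
begin

lemma integrable_cis: "f \<in> borel_measurable M \<Longrightarrow> integrable M (\<lambda>\<omega>. cis (f \<omega>))"
  by (intro integrable_const_bound[of _ 1]) (auto intro: measurable_compose)

text \<open>Convergence to zero in probability, through a truncated expectation: this is subadditive
  and directly bounds differences of characteristic functions.\<close>

definition vanishes_in_prob :: "(nat \<Rightarrow> 'a \<Rightarrow> real) \<Rightarrow> bool" where
  "vanishes_in_prob X \<longleftrightarrow> (\<forall>n. X n \<in> borel_measurable M) \<and> (\<forall>n \<omega>. 0 \<le> X n \<omega>) \<and>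
     (\<lambda>n. expectation (\<lambda>\<omega>. min 1 (X n \<omega>))) \<longlonglongrightarrow> 0"

lemma integrable_min_one: 
  "X \<in> borel_measurable M \<Longrightarrow> (\<And>\<omega>. 0 \<le> X \<omega>) \<Longrightarrow> integrable M (\<lambda>\<omega>. min 1 (X \<omega> :: real))"
  by (intro integrable_const_bound[of _ 1]) auto

lemma vanishes_in_prob_dominated:
  assumes X: "vanishes_in_prob X" and Y: "\<And>n. Y n \<in> borel_measurable M" "\<And>n \<omega>. 0 \<le> Y n \<omega>"
    and le: "\<And>n \<omega>. min 1 (Y n \<omega>) \<le> c * min 1 (X n \<omega>)"
  shows "vanishes_in_prob Y"
  unfolding vanishes_in_prob_def
proof (intro conjI allI Y)
  have lim: "(\<lambda>n. c * expectation (\<lambda>\<omega>. min 1 (X n \<omega>))) \<longlonglongrightarrow> c * 0"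
    using X unfolding vanishes_in_prob_def by (intro tendsto_intros) auto
  show "(\<lambda>n. expectation (\<lambda>\<omega>. min 1 (Y n \<omega>))) \<longlonglongrightarrow> 0"
  proof (rule Lim_null_comparison[OF always_eventually[OF allI] lim[unfolded mult_zero_right]])
    fix n
    have "expectation (\<lambda>\<omega>. min 1 (Y n \<omega>)) \<le> expectation (\<lambda>\<omega>. c * min 1 (X n \<omega>))"
      using X Y le unfolding vanishes_in_prob_def
      by (intro integral_mono integrable_min_one integrable_mult_right) auto
    moreover have "expectation (\<lambda>\<omega>. min 1 (Y n \<omega>)) \<ge> 0" using Y by (intro integral_nonneg_AE) auto
    ultimately show "norm (expectation (\<lambda>\<omega>. min 1 (Y n \<omega>))) \<le> c * expectation (\<lambda>\<omega>. min 1 (X n \<omega>))" by simp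
  qed
qed

lemma vanishes_in_prob_cmult:
  assumes "vanishes_in_prob X" "c \<ge> 0" shows "vanishes_in_prob (\<lambda>n \<omega>. c * X n \<omega>)"
\<comment> \<open>The factor \<open>1 + c\<close> serves both regimes: where
  \<open>X n \<omega> \<ge> 1\<close> the left side is at most 1, elsewhere it is at most
  \<open>c * X n \<omega>\<close>.\<close>
proof (rule vanishes_in_prob_dominated[OF assms(1), where c = "1 + c"])
  fix n \<omega>
  have "0 \<le> X n \<omega>" using assms by (simp add: vanishes_in_prob_def)
  then show "min 1 (c * X n \<omega>) \<le> (1 + c) * min 1 (X n \<omega>)"
    using assms(2) by (auto simp: min_def algebra_simps)
qed (use assms in \<open>auto simp: vanishes_in_prob_def intro!: borel_measurable_times\<close>)

lemma vanishes_in_prob_add: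
  assumes X: "vanishes_in_prob X" and Y: "vanishes_in_prob Y"
  shows "vanishes_in_prob (\<lambda>n \<omega>. X n \<omega> + Y n \<omega>)"
proof -
  have XY: "\<And>n. X n \<in> borel_measurable M" "\<And>n. Y n \<in> borel_measurable M"
    "\<And>n \<omega>. 0 \<le> X n \<omega>" "\<And>n \<omega>. 0 \<le> Y n \<omega>" using X Y by (auto simp: vanishes_in_prob_def)
  have lim: "(\<lambda>n. expectation (\<lambda>\<omega>. min 1 (X n \<omega>)) + expectation (\<lambda>\<omega>. min 1 (Y n \<omega>))) \<longlonglongrightarrow> 0 + 0"
    using X Y unfolding vanishes_in_prob_def by (intro tendsto_intros) auto
  have "(\<lambda>n. expectation (\<lambda>\<omega>. min 1 (X n \<omega> + Y n \<omega>))) \<longlonglongrightarrow> 0"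
  proof (rule Lim_null_comparison[OF always_eventually[OF allI] lim[unfolded add_0_right]])
    fix n
    have "expectation (\<lambda>\<omega>. min 1 (X n \<omega> + Y n \<omega>)) \<le> expectation (\<lambda>\<omega>. min 1 (X n \<omega>) + min 1 (Y n \<omega>))"
      using XY by (intro integral_mono integrable_min_one Bochner_Integration.integrable_add)
        (auto simp: min_def add_increasing add_increasing2)
    also have "\<dots> = expectation (\<lambda>\<omega>. min 1 (X n \<omega>)) + expectation (\<lambda>\<omega>. min 1 (Y n \<omega>))"
      using XY by (intro Bochner_Integration.integral_add integrable_min_one) auto
    finally show "norm (expectation (\<lambda>\<omega>. min 1 (X n \<omega> + Y n \<omega>))) \<le> expectation (\<lambda>\<omega>. min 1 (X n \<omega>)) + expectation (\<lambda>\<omega>. min 1 (Y n \<omega>))"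
      using XY by (subst real_norm_def, subst abs_of_nonneg) (auto intro!: integral_nonneg_AE)
  qed
  then show ?thesis using XY by (auto simp: vanishes_in_prob_def)
qed

lemma vanishes_in_prob_zero: "vanishes_in_prob (\<lambda>n \<omega>. 0)"
  by (simp add: vanishes_in_prob_def)

lemma vanishes_in_prob_sum:
  "finite J \<Longrightarrow> (\<And>j. j \<in> J \<Longrightarrow> vanishes_in_prob (X j)) \<Longrightarrow> vanishes_in_prob (\<lambda>n \<omega>. \<Sum>j\<in>J. X j n \<omega>)"
  by (induction J rule: finite_induct) (auto simp: vanishes_in_prob_add intro: vanishes_in_prob_zero)

text \<open>The bridge from the probabilities in \<open>is_wiener_integral\<close>: values up to
  \<open>r / 2\<close> contribute at most \<open>r / 2\<close>, and larger ones count at most 1 on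
  an event of probability below \<open>r / 2\<close>.\<close>

lemma vanishes_in_probI:
  assumes X: "\<And>n. X n \<in> borel_measurable M" "\<And>n \<omega>. 0 \<le> X n \<omega>"
    and P: "\<And>e. e > 0 \<Longrightarrow> (\<lambda>n. prob {\<omega>\<in>space M. e < X n \<omega>}) \<longlonglongrightarrow> 0"
  shows "vanishes_in_prob X"
  unfolding vanishes_in_prob_def
proof (intro conjI allI X LIMSEQ_I)
  fix r :: real assume r: "r > 0"
  obtain no where no: "\<And>n. n \<ge> no \<Longrightarrow> prob {\<omega>\<in>space M. r / 2 < X n \<omega>} < r / 2"
    using LIMSEQ_D[OF P[of "r / 2"], of "r / 2"] r by auto
  have "norm (expectation (\<lambda>\<omega>. min 1 (X n \<omega>)) - 0) < r" if n: "n \<ge> no" for n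
  proof -
    define A where "A = {\<omega>\<in>space M. r / 2 < X n \<omega>}"
    have A: "A \<in> events" unfolding A_def using X(1)[of n] by measurable
    have Ai: "integrable M (indicat_real A)" using A by (simp add: emeasure_eq_measure)
    have "expectation (\<lambda>\<omega>. min 1 (X n \<omega>)) \<le> expectation (\<lambda>\<omega>. r / 2 + indicator A \<omega>)"
    proof (intro integral_mono integrable_min_one Bochner_Integration.integrable_add Ai)
      show "min 1 (X n \<omega>) \<le> r / 2 + indicator A \<omega>" if "\<omega> \<in> space M" for \<omega>
        using that r by (cases "\<omega> \<in> A") (auto simp: A_def indicator_def min_def)
    qed (use X in auto)
    also have "\<dots> = r / 2 + prob A" using A Ai by (simp add: prob_space)
    also have "\<dots> < r" using no[OF n] by (simp add: A_def)
    finally show ?thesis using X by (simp add: integral_nonneg_AE)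
  qed
  then show "\<exists>no. \<forall>n\<ge>no. norm (expectation (\<lambda>\<omega>. min 1 (X n \<omega>)) - 0) < r" by blast
qed

lemma expectation_cis_tendsto:
  assumes V: "vanishes_in_prob V" and a: "\<And>n. a n \<in> borel_measurable M" and b: "b \<in> borel_measurable M"
    and le: "\<And>n \<omega>. \<bar>a n \<omega> - b \<omega>\<bar> \<le> V n \<omega>"
  shows "(\<lambda>n. expectation (\<lambda>\<omega>. cis (a n \<omega>))) \<longlonglongrightarrow> expectation (\<lambda>\<omega>. cis (b \<omega>))"
proof (rule Lim_null[THEN iffD2], rule Lim_null_comparison)
  show "(\<lambda>n. 2 * expectation (\<lambda>\<omega>. min 1 (V n \<omega>))) \<longlonglongrightarrow> 0"
    using V unfolding vanishes_in_prob_def by (auto intro: tendsto_mult_right_zero)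
  show "\<forall>\<^sub>F n in sequentially. norm (expectation (\<lambda>\<omega>. cis (a n \<omega>)) - expectation (\<lambda>\<omega>. cis (b \<omega>)))
     \<le> 2 * expectation (\<lambda>\<omega>. min 1 (V n \<omega>))"
  proof (rule always_eventually[OF allI])
    fix n
    have "expectation (\<lambda>\<omega>. cis (a n \<omega>)) - expectation (\<lambda>\<omega>. cis (b \<omega>)) = expectation (\<lambda>\<omega>. cis (a n \<omega>) - cis (b \<omega>))"
      using a b by (simp add: integrable_cis)
    also have "norm \<dots> \<le> expectation (\<lambda>\<omega>. norm (cis (a n \<omega>) - cis (b \<omega>)))"
      by (rule integral_norm_bound)
    also have "\<dots> \<le> expectation (\<lambda>\<omega>. 2 * min 1 (V n \<omega>))"
    proof (rule integral_mono)
      show "integrable M (\<lambda>\<omega>. norm (cis (a n \<omega>) - cis (b \<omega>)))"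
        using a b by (intro integrable_norm Bochner_Integration.integrable_diff integrable_cis)
      show "integrable M (\<lambda>\<omega>. 2 * min 1 (V n \<omega>))"
        using V by (intro integrable_mult_right integrable_min_one) (auto simp: vanishes_in_prob_def)
      show "norm (cis (a n \<omega>) - cis (b \<omega>)) \<le> 2 * min 1 (V n \<omega>)" for \<omega>
        using norm_cis_diff_le[of "a n \<omega>" "b \<omega>"] le[of n \<omega>] by (auto simp: min_def split: if_splits)
    qed
    finally show "norm (expectation (\<lambda>\<omega>. cis (a n \<omega>)) - expectation (\<lambda>\<omega>. cis (b \<omega>))) \<le> 2 * expectation (\<lambda>\<omega>. min 1 (V n \<omega>))"
      by simp
  qed
qed

text \<open>Moving each \<open>B i\<close> to the other side of the inner product leaves scalar
  functions of independent increments with covariance \<open>h *\<^sub>R mat 1\<close>, so the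
  expectation is a product of Gaussian factors.\<close>

lemma brownian_sum_characteristic:
  fixes W :: "real \<Rightarrow> 'a \<Rightarrow> real^'k" and B :: "nat \<Rightarrow> real^'k^'n"
  assumes bm: "std_brownian_motion M W" and h: "h > 0"
  shows "expectation (\<lambda>\<omega>. cis (v \<bullet> (\<Sum>i<n. B i *v (W (real (Suc i) * h) \<omega> - W (real i * h) \<omega>))))
     = complex_of_real (exp (- h / 2 * (\<Sum>i<n. (norm (transpose (B i) *v v))\<^sup>2)))"
proof -
  let ?D = "\<lambda>i \<omega>. W (real (Suc i) * h) \<omega> - W (real i * h) \<omega>"
  let ?w = "\<lambda>i. transpose (B i) *v v"
  have cis_sum: "cis (v \<bullet> (\<Sum>i<n. B i *v x i)) = (\<Prod>i<n. cis (?w i \<bullet> x i))" for x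
    by (induction n) (simp_all add: inner_add_right cis_mult[symmetric] dot_matrix_vector_mult)
  have "indep_vars (\<lambda>_. borel) ?D {..<n}"
    using bm[unfolded std_brownian_motion_def, THEN conjunct2, THEN conjunct2, THEN conjunct2,
      rule_format, of "\<lambda>i. real i * h" n] h by simp
  then have ind: "indep_vars (\<lambda>_. borel) (\<lambda>i \<omega>. cis (?w i \<bullet> ?D i \<omega>)) {..<n}"
    by (rule indep_vars_compose2[where Y="\<lambda>i x. cis (?w i \<bullet> x)"]) measurable
  have Wm: "W t \<in> borel_measurable M" for t using bm by (simp add: std_brownian_motion_def)
  have "expectation (\<lambda>\<omega>. cis (?w i \<bullet> ?D i \<omega>)) = complex_of_real (exp (- h / 2 * (norm (?w i))\<^sup>2))" for i
  proof -
    have "gaussian_law M (?D i) 0 ((real (Suc i) * h - real i * h) *\<^sub>R mat 1)"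
      using bm h unfolding std_brownian_motion_def by (simp add: mult_strict_right_mono)
    moreover have "real (Suc i) * h - real i * h = h" by (simp add: algebra_simps)
    moreover have "?w i \<bullet> ((h *\<^sub>R mat 1) *v ?w i) = h * (norm (?w i))\<^sup>2"
      by (simp add: scaleR_matrix_vector_assoc[symmetric] dot_square_norm)
    ultimately show ?thesis by (simp add: gaussian_law_def)
  qed
  moreover have "expectation (\<lambda>\<omega>. \<Prod>i<n. cis (?w i \<bullet> ?D i \<omega>)) = (\<Prod>i<n. expectation (\<lambda>\<omega>. cis (?w i \<bullet> ?D i \<omega>)))"
    by (rule indep_vars_lebesgue_integral[OF _ ind]) (use Wm in \<open>auto intro!: integrable_cis\<close>)
  ultimately show ?thesis
    by (simp add: cis_sum sum_distrib_left exp_sum del: of_nat_Suc)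
qed

end

lemma riemann_sum_dW_measurable:
  assumes "\<And>t. W t \<in> borel_measurable M"
  shows "riemann_sum_dW \<Gamma> W t n \<in> borel_measurable M"
  unfolding riemann_sum_dW_def[abs_def]
  by (intro borel_measurable_sum borel_measurable_matrix_vector_mult borel_measurable_diff assms)

section \<open>The law of the solution\<close>

text \<open>\<open>indep_var\<close> relates variables with values of one type, whereas the initial
  vector and the whole Brownian path have different types. Their functionals generate smaller
  sigma-algebras and so inherit independence.\<close>

lemma (in prob_space) indep_var_compose_indep_set:
  assumes ind: "indep_set (sets (vimage_algebra (space M) X S)) (sets (vimage_algebra (space M) Y T))"
    and X: "X \<in> measurable M S" and Y: "Y \<in> measurable M T"
    and f: "f \<in> measurable S N" and g: "g \<in> measurable T N"
  shows "indep_var N (\<lambda>\<omega>. f (X \<omega>)) N (\<lambda>\<omega>. g (Y \<omega>))"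
proof -
  have sub: "sigma_sets (space M) {(\<lambda>\<omega>. f (X \<omega>)) -` A \<inter> space M | A. A \<in> sets N}
      \<subseteq> sets (vimage_algebra (space M) X S)"
    if X: "X \<in> measurable M S" and f: "f \<in> measurable S N" for f X and S :: "'z measure"
  proof -
    have "(\<lambda>\<omega>. f (X \<omega>)) -` A \<inter> space M \<in> sets (vimage_algebra (space M) X S)" if A: "A \<in> sets N" for A
    proof -
      have "(\<lambda>\<omega>. f (X \<omega>)) -` A \<inter> space M = X -` (f -` A \<inter> space S) \<inter> space M"
        using measurable_space[OF X] by auto
      show ?thesis unfolding \<open>_ = X -` (f -` A \<inter> space S) \<inter> space M\<close>
        by (intro in_vimage_algebra measurable_sets[OF f A])
    qed
    then have "{(\<lambda>\<omega>. f (X \<omega>)) -` A \<inter> space M | A. A \<in> sets N} \<subseteq> sets (vimage_algebra (space M) X S)"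
      by blast
    from sets.sigma_sets_subset[OF this] show ?thesis by (simp only: space_vimage_algebra)
  qed
  have mono: "indep_set A B \<Longrightarrow> A' \<subseteq> A \<Longrightarrow> B' \<subseteq> B \<Longrightarrow> indep_set A' B'" for A A' B B'
    unfolding indep_sets2_eq by blast
  have "indep_set (sigma_sets (space M) {(\<lambda>\<omega>. f (X \<omega>)) -` A \<inter> space M | A. A \<in> sets N})
     (sigma_sets (space M) {(\<lambda>\<omega>. g (Y \<omega>)) -` A \<inter> space M | A. A \<in> sets N})"
    by (rule mono[OF ind sub[OF X f] sub[OF Y g]])
  then show ?thesis
    unfolding indep_var_eq using measurable_compose[OF X f] measurable_compose[OF Y g] by blast
qed

locale linear_sde = fundamental_matrix C \<Phi> + prob_space M
  for C \<Phi> :: "real \<Rightarrow> real^'n^'n" and M :: "'a measure" +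
  fixes \<Gamma> :: "real \<Rightarrow> real^'k^'n" and \<epsilon> :: real
    and W :: "real \<Rightarrow> 'a \<Rightarrow> real^'k" and Z :: "real \<Rightarrow> 'a \<Rightarrow> real^'n"
  assumes cont_\<Gamma>: "continuous_on {0..} \<Gamma>" and eps_pos: "\<epsilon> > 0"
    and brownian: "std_brownian_motion M W"
    and indep: "indep_set (sets (vimage_algebra (space M) (Z 0) borel))
       (sets (vimage_algebra (space M) (\<lambda>\<omega> t. W t \<omega>) (Pi\<^sub>M UNIV (\<lambda>_. borel))))"
    and solution: "linear_sde_solution M C \<Gamma> \<epsilon> W Z"
begin

lemma Z_measurable: "Z t \<in> borel_measurable M"
  using solution by (simp add: linear_sde_solution_def)

lemma W_measurable: "W t \<in> borel_measurable M"
  using brownian by (simp add: std_brownian_motion_def)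

lemma Z_cont: "\<omega> \<in> space M \<Longrightarrow> continuous_on {0..} (\<lambda>t. Z t \<omega>)"
  using solution by (simp add: linear_sde_solution_def)

text \<open>The stochastic integral of \<open>\<Psi> \<Gamma>\<close> is discretised on a grid of mesh \<open>T / N\<close> for
  \<open>\<Psi>\<close> which is refined to the mesh \<open>T / (N q)\<close> for \<open>\<Gamma>\<close>. All Riemann sums involved then live
  on one grid, so that the independence of increments is used only once.\<close>

definition double_sum :: "real \<Rightarrow> nat \<Rightarrow> nat \<Rightarrow> 'a \<Rightarrow> real^'n" where
  "double_sum T N q \<omega> = (\<Sum>j<N. \<Psi> (real j * T / real N) *v
     (riemann_sum_dW \<Gamma> W (real (Suc j) * T / real N) (Suc j * q) \<omega> -
      riemann_sum_dW \<Gamma> W (real j * T / real N) (j * q) \<omega>))"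

text \<open>The fine cell \<open>i\<close> lies in the coarse cell \<open>i div q\<close>;
  \<open>\<Psi>\<close> stays frozen at the left end of the latter, while \<open>\<Gamma>\<close> is
  read at the left end of the former.\<close>

definition double_coeff :: "real \<Rightarrow> nat \<Rightarrow> nat \<Rightarrow> nat \<Rightarrow> real^'k^'n" where
  "double_coeff T N q i = \<Psi> (real (i div q) * T / real N) ** \<Gamma> (real i * T / real (N * q))"

text \<open>With \<open>j * q\<close> cells up to the \<open>j\<close>-th coarse node, every Riemann
  sum has mesh \<open>T / (N * q)\<close>. It is then an initial segment of one fixed sum, and
  differences at neighbouring nodes are blocks of \<open>q\<close> terms.\<close>

lemma double_sum_eq:
  assumes "N > 0" "q > 0"
  shows "double_sum T N q \<omega> = (\<Sum>i<N * q. double_coeff T N q i *v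
     (W (real (Suc i) * (T / real (N * q))) \<omega> - W (real i * (T / real (N * q))) \<omega>))"
proof -
  let ?g = "\<lambda>i. \<Gamma> (real i * T / real (N * q)) *v
     (W (real (Suc i) * (T / real (N * q))) \<omega> - W (real i * (T / real (N * q))) \<omega>)"
  have rs: "riemann_sum_dW \<Gamma> W (real j * T / real N) (j * q) \<omega> = (\<Sum>i<j * q. ?g i)" for j
  \<comment> \<open>For \<open>j = 0\<close> there are no cells and the mesh would be a division by
    zero; both sums are empty.\<close>
  proof (cases "j = 0")
    case False
    then have "real i * (real j * T / real N) / real (j * q) = real i * T / real (N * q)" for i
      by (simp add: field_simps)
    then show ?thesis by (simp add: riemann_sum_dW_def del: of_nat_mult of_nat_Suc)
  qed (simp add: riemann_sum_dW_def)
  have "double_sum T N q \<omega> = (\<Sum>j<N. \<Psi> (real j * T / real N) *v (\<Sum>i\<in>{j * q..<j * q + q}. ?g i))"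
    unfolding double_sum_def rs
  proof (intro sum.cong refl arg_cong[where f="\<lambda>x. _ *v x"])
    fix j
    have "(\<Sum>i<m + q. g i) - (\<Sum>i<m. g i) = (\<Sum>i\<in>{m..<m + q}. g i)" for m and g :: "nat \<Rightarrow> real^'n"
      by (induction q) auto
    from this[of ?g "j * q"] show "(\<Sum>i<Suc j * q. ?g i) - (\<Sum>i<j * q. ?g i) = (\<Sum>i\<in>{j * q..<j * q + q}. ?g i)"
      by (simp only: mult_Suc add.commute)
  qed
  also have "\<dots> = (\<Sum>j<N. \<Sum>i\<in>{j * q..<j * q + q}. \<Psi> (real (i div q) * T / real N) *v ?g i)"
  proof (intro sum.cong refl)
    fix j
    have dv: "i div q = j" if "i \<in> {j * q..<j * q + q}" for i
      using that assms by (intro div_nat_eqI) (auto simp: mult.commute)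
    have "\<Psi> (real j * T / real N) *v (\<Sum>i\<in>{j * q..<j * q + q}. ?g i) =
       (\<Sum>i\<in>{j * q..<j * q + q}. \<Psi> (real j * T / real N) *v ?g i)"
      by (rule linear_sum[OF matrix_vector_mul_linear])
    also have "\<dots> = (\<Sum>i\<in>{j * q..<j * q + q}. \<Psi> (real (i div q) * T / real N) *v ?g i)"
      by (intro sum.cong refl) (simp only: dv)
    finally show "\<Psi> (real j * T / real N) *v (\<Sum>i\<in>{j * q..<j * q + q}. ?g i) =
       (\<Sum>i\<in>{j * q..<j * q + q}. \<Psi> (real (i div q) * T / real N) *v ?g i)" .
  qed
  also have "\<dots> = (\<Sum>i<N * q. \<Psi> (real (i div q) * T / real N) *v ?g i)"
    by (rule sum.nat_group)
  finally show ?thesis unfolding double_coeff_def matrix_vector_mul_assoc .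
qed

lemma double_sum_characteristic:
  assumes T: "T > 0" and N: "N > 0" "q > 0"
  shows "expectation (\<lambda>\<omega>. cis (v \<bullet> Z 0 \<omega> + v \<bullet> (sqrt \<epsilon> *\<^sub>R double_sum T N q \<omega>))) =
    expectation (\<lambda>\<omega>. cis (v \<bullet> Z 0 \<omega>)) *
    complex_of_real (exp (- \<epsilon> / 2 * (\<Sum>i<N * q. (T / real (N * q)) * (norm (transpose (double_coeff T N q i) *v v))\<^sup>2)))"
proof -
  let ?h = "T / real (N * q)"
  \<comment> \<open>A functional of the whole path, as the independence assumption concerns the
    sigma-algebra of \<open>W\<close> on path space. The factor \<open>sqrt \<epsilon>\<close> sits
    on \<open>v\<close>, where \<open>brownian_sum_characteristic\<close> can absorb it.\<close>
  define G where "G = (\<lambda>w :: real \<Rightarrow> real^'k. cis ((sqrt \<epsilon> *\<^sub>R v) \<bullet> (\<Sum>i<N * q. double_coeff T N q i *v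
     (w (real (Suc i) * ?h) - w (real i * ?h)))))"
  have Gm: "G \<in> borel_measurable (Pi\<^sub>M UNIV (\<lambda>_. borel))"
    unfolding G_def by measurable
  have cm: "(\<lambda>x. cis (v \<bullet> x)) \<in> borel_measurable borel" by measurable
  have Wm: "(\<lambda>\<omega> t. W t \<omega>) \<in> measurable M (Pi\<^sub>M UNIV (\<lambda>_. borel))"
    by (rule measurable_PiM_single') (auto simp: W_measurable)
  note ind = indep_var_compose_indep_set[OF indep Z_measurable Wm cm Gm]
  have G: "G (\<lambda>t. W t \<omega>) = cis (v \<bullet> (sqrt \<epsilon> *\<^sub>R double_sum T N q \<omega>))" for \<omega>
    by (simp add: G_def double_sum_eq[OF N])
  have "expectation (\<lambda>\<omega>. G (\<lambda>t. W t \<omega>)) = complex_of_real (exp (- ?h / 2 * (\<Sum>i<N * q.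
      (norm (transpose (double_coeff T N q i) *v (sqrt \<epsilon> *\<^sub>R v)))\<^sup>2)))"
    unfolding G_def using T N by (intro brownian_sum_characteristic[OF brownian]) simp
  also have "- ?h / 2 * (\<Sum>i<N * q. (norm (transpose (double_coeff T N q i) *v (sqrt \<epsilon> *\<^sub>R v)))\<^sup>2) =
     - \<epsilon> / 2 * (\<Sum>i<N * q. ?h * (norm (transpose (double_coeff T N q i) *v v))\<^sup>2)"
  proof -
    have "- h / 2 * (\<Sum>i\<in>I. \<epsilon> * x i) = - \<epsilon> / 2 * (\<Sum>i\<in>I. h * x i)" for h x and I :: "nat set"
      by (simp add: sum_distrib_left[symmetric])
    moreover have "\<bar>sqrt \<epsilon>\<bar>\<^sup>2 = \<epsilon>" using eps_pos by simp
    ultimately show ?thesis unfolding matrix_vector_mult_scaleR norm_scaleR power_mult_distrib by (simp only:)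
  qed
  finally have EG: "expectation (\<lambda>\<omega>. G (\<lambda>t. W t \<omega>)) = complex_of_real (exp
     (- \<epsilon> / 2 * (\<Sum>i<N * q. ?h * (norm (transpose (double_coeff T N q i) *v v))\<^sup>2)))" .
  have "integrable M (\<lambda>\<omega>. cis (v \<bullet> Z 0 \<omega>))" "integrable M (\<lambda>\<omega>. G (\<lambda>t. W t \<omega>))"
    unfolding G_def using Z_measurable W_measurable by (auto intro!: integrable_cis)
  from indep_var_lebesgue_integral[OF ind this] show ?thesis
    unfolding EG by (simp only: G cis_mult)
qed

text \<open>A Riemann sum with two tags per cell, a coarse one for \<open>\<Psi>\<close> and a fine
  one for \<open>\<Gamma>\<close>. Only the coarse mesh limits the error, so the refinements
  \<open>q N\<close> stay free for the later diagonal choice.\<close>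

lemma double_sum_variance:
  assumes T: "T > 0" and q: "\<And>N. q N > 0"
  shows "(\<lambda>N. \<Sum>i<Suc N * q N. (T / real (Suc N * q N)) * (norm (transpose (double_coeff T (Suc N) (q N) i) *v v))\<^sup>2)
     \<longlonglongrightarrow> integral {0..T} (\<lambda>s. (norm (transpose (\<Psi> s ** \<Gamma> s) *v v))\<^sup>2)"
proof (rule LIMSEQ_I)
  fix r :: real assume r: "r > 0"
  define f where "f = (\<lambda>a b. (norm (transpose (\<Psi> a ** \<Gamma> b) *v v))\<^sup>2)"
  define F where "F = (\<lambda>(a, s, b). f a b - f s s)"
  have c\<Psi>: "continuous_on {0..T} \<Psi>" and c\<Gamma>: "continuous_on {0..T} \<Gamma>"
    by (rule continuous_on_subset[OF cont_\<Psi>], simp, rule continuous_on_subset[OF cont_\<Gamma>], simp)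
  have cont: "continuous_on ({0..T} \<times> {0..T} \<times> {0..T}) F"
    unfolding F_def f_def split_beta
    by (intro continuous_intros continuous_on_compose2[OF c\<Psi>] continuous_on_compose2[OF c\<Gamma>]) auto
  have contf: "continuous_on {0..T} (\<lambda>s. f s s)"
    unfolding f_def by (intro continuous_intros c\<Psi> c\<Gamma>)
  have r2: "r / 2 > 0" using r by simp
  obtain \<delta> where \<delta>: "\<delta> > 0" and small: "\<And>n a b. n > 0 \<Longrightarrow>
       (\<And>i s. i < n \<Longrightarrow> s \<in> {real i * T / n..real (Suc i) * T / n} \<Longrightarrow>
          a i \<in> {0..T} \<and> b i \<in> {0..T} \<and> \<bar>a i - s\<bar> < \<delta> \<and> \<bar>b i - s\<bar> < \<delta>) \<Longrightarrow>
       norm (\<Sum>i<n. integral {real i * T / n..real (Suc i) * T / n} (\<lambda>s. F (a i, s, b i))) \<le> r / 2"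
    by (rule sum_cell_integrals_small[OF cont _ T r2]) (auto simp: F_def)
  obtain N0 where N0: "T / \<delta> < real N0" using reals_Archimedean2 by blast
  have "norm ((\<Sum>i<Suc N * q N. (T / real (Suc N * q N)) * (norm (transpose (double_coeff T (Suc N) (q N) i) *v v))\<^sup>2)
      - integral {0..T} (\<lambda>s. (norm (transpose (\<Psi> s ** \<Gamma> s) *v v))\<^sup>2)) < r" if N: "N \<ge> N0" for N
  proof -
    define n where "n = Suc N * q N"
    define a where "a = (\<lambda>i. real (i div q N) * T / real (Suc N))"
    define b where "b = (\<lambda>i. real i * T / real n)"
    have n: "n > 0" using q by (simp add: n_def)
    have "T / \<delta> < real (Suc N)" using N0 N by simp
    then have mesh: "T / real (Suc N) < \<delta>" using \<delta> T by (simp add: divide_less_eq mult.commute)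
    have range: "a i \<in> {0..T} \<and> b i \<in> {0..T} \<and> \<bar>a i - s\<bar> < \<delta> \<and> \<bar>b i - s\<bar> < \<delta>"
      if i: "i < n" and s: "s \<in> {real i * T / n..real (Suc i) * T / n}" for i s
    proof -
      define j where "j = i div q N"
      have "j * q N \<le> i" unfolding j_def by simp
      \<comment> \<open>The right end of the fine cell must still lie in the coarse cell, so that
        both tags are within one coarse mesh of each \<open>s\<close>.\<close>
      moreover have "Suc i \<le> Suc j * q N" unfolding j_def
        by (metis Suc_leI dividend_less_times_div mult.commute mult_Suc_right q)
      ultimately have ji: "real j * real (q N) \<le> real i" "real (Suc i) \<le> real (Suc j) * real (q N)"
        by (simp_all only: of_nat_mult[symmetric] of_nat_le_iff)
      have jN: "j < Suc N" using i unfolding j_def n_def by (simp add: less_mult_imp_div_less)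
      have scale: "real l * T / real (Suc N) = (real l * real (q N)) * T / real n" for l
      proof -
        have "real n = real (Suc N) * real (q N)" by (simp only: n_def of_nat_mult)
        then show ?thesis using q[of N] by (simp add: field_simps del: of_nat_Suc)
      qed
      have lo: "real j * T / real (Suc N) \<le> real i * T / n"
        unfolding scale using ji(1) T by (intro divide_right_mono mult_right_mono) auto
      have hi: "real (Suc i) * T / n \<le> real (Suc j) * T / real (Suc N)"
        unfolding scale using ji(2) T by (intro divide_right_mono mult_right_mono) auto
      note gj = grid_cell_bounds[OF jN less_imp_le[OF T]]
      note gi = grid_cell_bounds[OF i less_imp_le[OF T]]
      show ?thesis using lo hi gj gi mesh s
        unfolding a_def b_def j_def[symmetric] atLeastAtMost_iff abs_less_iff by linarith
    qed
    have cell: "(T / real n) * f (a i) (b i) - integral {real i * T / n..real (Suc i) * T / n} (\<lambda>s. f s s)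
        = integral {real i * T / n..real (Suc i) * T / n} (\<lambda>s. F (a i, s, b i))" if i: "i < n" for i
    proof -
      note g = grid_cell_bounds[OF i less_imp_le[OF T]]
      have "(\<lambda>s. f s s) integrable_on {real i * T / n..real (Suc i) * T / n}"
        by (intro integrable_continuous_interval continuous_on_subset[OF contf])
          (use g(1,3) in \<open>auto simp del: of_nat_Suc\<close>)
      then have "integral {real i * T / n..real (Suc i) * T / n} (\<lambda>s. F (a i, s, b i)) =
        (real (Suc i) * T / n - real i * T / n) * f (a i) (b i) - integral {real i * T / n..real (Suc i) * T / n} (\<lambda>s. f s s)"
        unfolding F_def prod.case using g(2)
        by (subst Henstock_Kurzweil_Integration.integral_diff) (auto simp del: of_nat_Suc)
      then show ?thesis unfolding g(4) by simp
    qed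
    have "(\<Sum>i<n. (T / real n) * f (a i) (b i)) - integral {0..T} (\<lambda>s. f s s) =
       (\<Sum>i<n. integral {real i * T / n..real (Suc i) * T / n} (\<lambda>s. F (a i, s, b i)))"
      unfolding integral_equal_cells[OF contf less_imp_le[OF T] n] sum_subtractf[symmetric]
      by (intro sum.cong refl cell) simp
    then have "norm ((\<Sum>i<n. (T / real n) * f (a i) (b i)) - integral {0..T} (\<lambda>s. f s s)) \<le> r / 2"
      using small[OF n, of a b, OF range] by simp
    then show ?thesis using r unfolding f_def a_def b_def n_def double_coeff_def by linarith
  qed
  then show "\<exists>no. \<forall>N\<ge>no. norm ((\<Sum>i<Suc N * q N. (T / real (Suc N * q N)) * (norm (transpose (double_coeff T (Suc N) (q N) i) *v v))\<^sup>2)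
      - integral {0..T} (\<lambda>s. (norm (transpose (\<Psi> s ** \<Gamma> s) *v v))\<^sup>2)) < r" by blast
qed

text \<open>A version of \<open>sqrt \<epsilon>\<close> times the Wiener integral that is defined on
  every path; the two agree almost surely at each fixed time.\<close>

definition noise :: "real \<Rightarrow> 'a \<Rightarrow> real^'n" where
  "noise t \<omega> = Z t \<omega> - Z 0 \<omega> - integral {0..t} (\<lambda>s. C s *v Z s \<omega>)"

text \<open>On a cell \<open>[a, b]\<close>, \<open>\<Psi> a\<close> times the noise increment differs from the increment of \<open>\<Psi> Z\<close>
  by the integral over \<open>s\<close> of a continuous function of \<open>(a, s, b)\<close> that vanishes on the diagonal;
  this replaces the stochastic integration by parts.\<close>

lemma noise_sum_tendsto:
  assumes T: "T > 0" and \<omega>: "\<omega> \<in> space M"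
  shows "(\<lambda>N. \<Sum>j<Suc N. \<Psi> (real j * T / real (Suc N)) *v
      (noise (real (Suc j) * T / real (Suc N)) \<omega> - noise (real j * T / real (Suc N)) \<omega>))
    \<longlonglongrightarrow> \<Psi> T *v Z T \<omega> - Z 0 \<omega>"
proof (rule LIMSEQ_I)
  fix r :: real assume r: "r > 0"
  define z where "z = (\<lambda>t. Z t \<omega>)"
  \<comment> \<open>The first term is the integrand behind \<open>\<Psi> a - \<Psi> b = \<Psi> b **
    (\<Phi> b - \<Phi> a) ** \<Psi> a\<close>, with the increment of \<open>\<Phi>\<close> written
    as the integral of \<open>C s ** \<Phi> s\<close>; thus \<open>\<Psi>\<close> itself is never
    differentiated. The second term comes from the drift removed in \<open>noise\<close>.\<close>
  define F where "F = (\<lambda>(a, s, b). (\<Psi> b ** (C s ** \<Phi> s) ** \<Psi> a) *v z b - \<Psi> a *v (C s *v z s))"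
  have c\<Psi>: "continuous_on {0..T} \<Psi>" and c\<Phi>: "continuous_on {0..T} \<Phi>" and cC: "continuous_on {0..T} C"
    and cz: "continuous_on {0..T} z"
    using continuous_on_subset[OF cont_\<Psi>] continuous_on_subset[OF cont_\<Phi>] continuous_on_subset[OF cont_C]
      continuous_on_subset[OF Z_cont[OF \<omega>]] unfolding z_def by auto
  have cont: "continuous_on ({0..T} \<times> {0..T} \<times> {0..T}) F"
    unfolding F_def split_beta
    by (intro continuous_intros continuous_on_compose2[OF c\<Psi>] continuous_on_compose2[OF c\<Phi>]
        continuous_on_compose2[OF cC] continuous_on_compose2[OF cz]) auto
  have diag: "F (s, s, s) = 0" if "s \<in> {0..T}" for s
  proof -
    have "\<Psi> s ** (C s ** \<Phi> s) ** \<Psi> s = \<Psi> s ** C s ** (\<Phi> s ** \<Psi> s)" by (simp add: matrix_mul_assoc)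
    then show ?thesis using that by (simp add: F_def \<Phi>\<Psi> matrix_vector_mul_assoc)
  qed
  have r2: "r / 2 > 0" using r by simp
  obtain \<delta> where \<delta>: "\<delta> > 0" and small: "\<And>n a b. n > 0 \<Longrightarrow>
       (\<And>i s. i < n \<Longrightarrow> s \<in> {real i * T / n..real (Suc i) * T / n} \<Longrightarrow>
          a i \<in> {0..T} \<and> b i \<in> {0..T} \<and> \<bar>a i - s\<bar> < \<delta> \<and> \<bar>b i - s\<bar> < \<delta>) \<Longrightarrow>
       norm (\<Sum>i<n. integral {real i * T / n..real (Suc i) * T / n} (\<lambda>s. F (a i, s, b i))) \<le> r / 2"
    by (rule sum_cell_integrals_small[OF cont diag T r2]) auto
  obtain N0 where N0: "T / \<delta> < real N0" using reals_Archimedean2 by blast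
  have step: "\<Psi> a *v (noise b \<omega> - noise a \<omega>) - (\<Psi> b *v z b - \<Psi> a *v z a) = integral {a..b} (\<lambda>s. F (a, s, b))"
    if ab: "0 \<le> a" "a \<le> b" "b \<le> T" for a b
  proof -
    have iCz: "(\<lambda>s. C s *v z s) integrable_on {c..d}" if "0 \<le> c" "d \<le> T" for c d
      by (intro integrable_continuous_interval continuous_intros continuous_on_subset[OF cC] continuous_on_subset[OF cz])
        (use that in auto)
    have "integral {0..b} (\<lambda>s. C s *v z s) = integral {0..a} (\<lambda>s. C s *v z s) + integral {a..b} (\<lambda>s. C s *v z s)"
      by (rule Henstock_Kurzweil_Integration.integral_combine[symmetric]) (use ab iCz in auto)
    then have nd: "noise b \<omega> - noise a \<omega> = z b - z a - integral {a..b} (\<lambda>s. C s *v z s)"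
      by (simp add: noise_def z_def)
    have "((\<lambda>s. \<Psi> a *v (C s *v z s)) has_integral \<Psi> a *v integral {a..b} (\<lambda>s. C s *v z s)) {a..b}"
      using has_integral_linear[OF integrable_integral[OF iCz] matrix_vector_mul_bounded_linear, of a b "\<Psi> a"] ab
      by (simp add: o_def)
    moreover have "((\<lambda>s. (\<Psi> b ** (C s ** \<Phi> s) ** \<Psi> a) *v z b) has_integral (\<Psi> b ** (\<Phi> b - \<Phi> a) ** \<Psi> a) *v z b) {a..b}"
      using has_integral_linear[OF \<Phi>_increment[OF ab(1,2)] bounded_linear_compose[OF
        bounded_bilinear.bounded_linear_left[OF bounded_bilinear_matrix_vector_mult, of "z b"]
        bounded_linear_congruence[of "\<Psi> b" "\<Psi> a"]]]
      by (simp add: o_def)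
    ultimately have "((\<lambda>s. F (a, s, b)) has_integral
       (\<Psi> b ** (\<Phi> b - \<Phi> a) ** \<Psi> a) *v z b - \<Psi> a *v integral {a..b} (\<lambda>s. C s *v z s)) {a..b}"
      unfolding F_def prod.case by (intro has_integral_diff)
    moreover have "(\<Psi> b ** (\<Phi> b - \<Phi> a) ** \<Psi> a) = \<Psi> a - \<Psi> b"
      using \<Psi>_diff[of b a] ab by (simp add: algebra_simps)
    ultimately have "integral {a..b} (\<lambda>s. F (a, s, b)) = (\<Psi> a - \<Psi> b) *v z b - \<Psi> a *v integral {a..b} (\<lambda>s. C s *v z s)"
      by (simp add: integral_unique)
    then show ?thesis unfolding nd
      by (simp add: matrix_vector_mult_diff_distrib matrix_vector_mult_diff_rdistrib)
  qed
  have "norm ((\<Sum>j<Suc N. \<Psi> (real j * T / real (Suc N)) *v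
      (noise (real (Suc j) * T / real (Suc N)) \<omega> - noise (real j * T / real (Suc N)) \<omega>)) - (\<Psi> T *v Z T \<omega> - Z 0 \<omega>)) < r"
    if N: "N \<ge> N0" for N
  proof -
    let ?t = "\<lambda>j. real j * T / real (Suc N)"
    have "T / \<delta> < real (Suc N)" using N0 N by simp
    then have mesh: "T / real (Suc N) < \<delta>" using \<delta> T by (simp add: divide_less_eq mult.commute)
    have range: "?t i \<in> {0..T} \<and> ?t (Suc i) \<in> {0..T} \<and> \<bar>?t i - s\<bar> < \<delta> \<and> \<bar>?t (Suc i) - s\<bar> < \<delta>"
      if i: "i < Suc N" and s: "s \<in> {?t i..?t (Suc i)}" for i s
      using grid_cell_bounds[OF i less_imp_le[OF T]] mesh s
      unfolding atLeastAtMost_iff abs_less_iff by linarith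
    \<comment> \<open>The increments of \<open>\<Psi> Z\<close> telescope, and the lower end is
      \<open>Z 0 \<omega>\<close> because \<open>\<Psi> 0\<close> is the identity.\<close>
    have "\<Psi> T *v Z T \<omega> - Z 0 \<omega> = (\<Sum>j<Suc N. \<Psi> (?t (Suc j)) *v z (?t (Suc j)) - \<Psi> (?t j) *v z (?t j))"
      using \<Psi>\<Phi>[of 0] init
      by (subst sum_lessThan_telescope[of "\<lambda>j. \<Psi> (?t j) *v z (?t j)"]) (simp add: z_def)
    then have "(\<Sum>j<Suc N. \<Psi> (?t j) *v (noise (?t (Suc j)) \<omega> - noise (?t j) \<omega>)) - (\<Psi> T *v Z T \<omega> - Z 0 \<omega>)
      = (\<Sum>j<Suc N. integral {?t j..?t (Suc j)} (\<lambda>s. F (?t j, s, ?t (Suc j))))"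
      using grid_cell_bounds[where n="Suc N", OF _ less_imp_le[OF T]]
      by (simp only: sum_subtractf[symmetric]) (intro sum.cong refl step, auto simp del: of_nat_Suc)
    also have "norm \<dots> \<le> r / 2" using small[of "Suc N" ?t "\<lambda>j. ?t (Suc j)", OF _ range] by simp
    finally show ?thesis using r by simp
  qed
  then show "\<exists>no. \<forall>N\<ge>no. norm ((\<Sum>j<Suc N. \<Psi> (real j * T / real (Suc N)) *v
      (noise (real (Suc j) * T / real (Suc N)) \<omega> - noise (real j * T / real (Suc N)) \<omega>)) - (\<Psi> T *v Z T \<omega> - Z 0 \<omega>)) < r"
    by blast
qed


text \<open>\<open>E1 N q\<close> uses Riemann sums, \<open>E2 N\<close> the Wiener integrals at the
  coarse nodes. \<open>E1 N q\<close> tends to \<open>E2 N\<close> in \<open>q\<close>, and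
  \<open>E2\<close> tends to the characteristic function of \<open>Z T\<close>; along a diagonal the
  explicit value of \<open>E1\<close> has the stated limit.\<close>

lemma solution_characteristic:
  assumes t: "T \<ge> 0"
  shows "expectation (\<lambda>\<omega>. cis (u \<bullet> Z T \<omega>)) =
    expectation (\<lambda>\<omega>. cis ((transpose (\<Phi> T) *v u) \<bullet> Z 0 \<omega>)) *
    complex_of_real (exp (- \<epsilon> / 2 *
      integral {0..T} (\<lambda>s. (norm (transpose (\<Psi> s ** \<Gamma> s) *v (transpose (\<Phi> T) *v u)))\<^sup>2)))"
proof (cases "T = 0")
  case True then show ?thesis by (simp add: init transpose_mat)
next
  case False
  with t have T: "T > 0" by simp
  \<comment> \<open>Chosen so that \<open>v \<bullet> (\<Psi> T *v Z T \<omega>) = u \<bullet> Z T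
    \<omega>\<close>.\<close>
  define v where "v = transpose (\<Phi> T) *v u"
  define c0 where "c0 = expectation (\<lambda>\<omega>. cis (v \<bullet> Z 0 \<omega>))"
  define L where "L = integral {0..T} (\<lambda>s. (norm (transpose (\<Psi> s ** \<Gamma> s) *v v))\<^sup>2)"
  have "\<exists>I. \<forall>t\<ge>0. is_wiener_integral M \<Gamma> W t (I t) \<and>
     (AE \<omega> in M. Z t \<omega> = Z 0 \<omega> + integral {0..t} (\<lambda>s. C s *v Z s \<omega>) + sqrt \<epsilon> *\<^sub>R I t \<omega>)"
    using solution unfolding linear_sde_solution_def by meson
  then obtain I where I: "\<And>t. t \<ge> 0 \<Longrightarrow> is_wiener_integral M \<Gamma> W t (I t)"
    and ZI: "\<And>t. t \<ge> 0 \<Longrightarrow> AE \<omega> in M. Z t \<omega> = Z 0 \<omega> + integral {0..t} (\<lambda>s. C s *v Z s \<omega>) + sqrt \<epsilon> *\<^sub>R I t \<omega>"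
    by blast
  define \<tau> where "\<tau> = (\<lambda>N j. real j * T / real (Suc N))"
  have \<tau>: "real j * T / real (Suc N) = \<tau> N j" for N j by (simp only: \<tau>_def)
  have \<tau>0: "\<tau> N j \<ge> 0" for N j using T by (simp add: \<tau>_def)
  have Im: "I (\<tau> N j) \<in> borel_measurable M" for N j using I[OF \<tau>0] by (simp add: is_wiener_integral_def)
  define D where "D = (\<lambda>N \<omega>. sqrt \<epsilon> *\<^sub>R (\<Sum>j<Suc N. \<Psi> (\<tau> N j) *v (I (\<tau> N (Suc j)) \<omega> - I (\<tau> N j) \<omega>)))"
  have Dm: "D N \<in> borel_measurable M" for N
    unfolding D_def using Im by (intro borel_measurable_scaleR borel_measurable_sum borel_measurable_matrix_vector_mult
        borel_measurable_diff) auto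
  define d where "d = (\<lambda>N j q \<omega>. dist (riemann_sum_dW \<Gamma> W (\<tau> N j) (j * q) \<omega>) (I (\<tau> N j) \<omega>))"
  have vanish: "vanishes_in_prob (d N j)" for N j
  proof (rule vanishes_in_probI)
    show "d N j q \<in> borel_measurable M" for q
      unfolding d_def using riemann_sum_dW_measurable[OF W_measurable] Im by (intro borel_measurable_dist)
    fix e :: real assume e: "e > 0"
    let ?P = "\<lambda>n. prob {\<omega>\<in>space M. e < dist (riemann_sum_dW \<Gamma> W (\<tau> N j) n \<omega>) (I (\<tau> N j) \<omega>)}"
    have lim: "?P \<longlonglongrightarrow> 0" using I[OF \<tau>0] e by (simp add: is_wiener_integral_def)
    show "(\<lambda>q. prob {\<omega>\<in>space M. e < d N j q \<omega>}) \<longlonglongrightarrow> 0"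
    \<comment> \<open>For \<open>j > 0\<close> the cell counts \<open>j * q\<close> run through a
      subsequence. For \<open>j = 0\<close> they are constantly zero, but all Riemann sums up to
      time zero vanish, so the probability does not depend on the count.\<close>
    proof (cases "j = 0")
      case True
      then have "riemann_sum_dW \<Gamma> W (\<tau> N j) n \<omega> = 0" for n \<omega> by (simp add: riemann_sum_dW_def \<tau>_def)
      then show ?thesis using lim by (simp add: d_def)
    next
      case False
      then have "strict_mono (\<lambda>q. j * q)" by (simp add: strict_mono_def)
      from LIMSEQ_subseq_LIMSEQ[OF lim this] show ?thesis by (simp add: d_def o_def)
    qed
  qed (simp add: d_def)
  define E1 where "E1 = (\<lambda>N q. expectation (\<lambda>\<omega>. cis (v \<bullet> Z 0 \<omega> + v \<bullet> (sqrt \<epsilon> *\<^sub>R double_sum T (Suc N) q \<omega>))))"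
  define E2 where "E2 = (\<lambda>N. expectation (\<lambda>\<omega>. cis (v \<bullet> Z 0 \<omega> + v \<bullet> D N \<omega>)))"
  have lim1: "E1 N \<longlonglongrightarrow> E2 N" for N
    unfolding E1_def E2_def
  proof (rule expectation_cis_tendsto)
    let ?K = "\<lambda>j. sqrt \<epsilon> * norm (transpose (\<Psi> (\<tau> N j)) *v v)"
    show "vanishes_in_prob (\<lambda>q \<omega>. \<Sum>j<Suc N. ?K j * (d N (Suc j) q \<omega> + d N j q \<omega>))"
      using eps_pos by (intro vanishes_in_prob_sum vanishes_in_prob_cmult vanishes_in_prob_add vanish) auto
    show "(\<lambda>\<omega>. v \<bullet> Z 0 \<omega> + v \<bullet> (sqrt \<epsilon> *\<^sub>R double_sum T (Suc N) q \<omega>)) \<in> borel_measurable M" for q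
      unfolding double_sum_def
      using riemann_sum_dW_measurable[OF W_measurable] Z_measurable
      by (intro borel_measurable_add borel_measurable_inner borel_measurable_scaleR borel_measurable_sum
          borel_measurable_matrix_vector_mult borel_measurable_diff) auto
    show "(\<lambda>\<omega>. v \<bullet> Z 0 \<omega> + v \<bullet> D N \<omega>) \<in> borel_measurable M"
      using Z_measurable Dm by (intro borel_measurable_add borel_measurable_inner) auto
    fix q \<omega>
    let ?R = "\<lambda>j. riemann_sum_dW \<Gamma> W (\<tau> N j) (j * q) \<omega>"
    let ?e = "\<lambda>j. ?R j - I (\<tau> N j) \<omega>"
    have "(v \<bullet> Z 0 \<omega> + v \<bullet> (sqrt \<epsilon> *\<^sub>R double_sum T (Suc N) q \<omega>)) - (v \<bullet> Z 0 \<omega> + v \<bullet> D N \<omega>)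
        = sqrt \<epsilon> * (v \<bullet> (double_sum T (Suc N) q \<omega> - (\<Sum>j<Suc N. \<Psi> (\<tau> N j) *v (I (\<tau> N (Suc j)) \<omega> - I (\<tau> N j) \<omega>))))"
      by (simp only: D_def inner_diff_right inner_scaleR_right right_diff_distrib add_diff_cancel_left)
    also have "double_sum T (Suc N) q \<omega> - (\<Sum>j<Suc N. \<Psi> (\<tau> N j) *v (I (\<tau> N (Suc j)) \<omega> - I (\<tau> N j) \<omega>))
        = (\<Sum>j<Suc N. \<Psi> (\<tau> N j) *v (?e (Suc j) - ?e j))"
      unfolding double_sum_def \<tau> sum_subtractf[symmetric]
      by (intro sum.cong refl) (simp add: matrix_vector_mult_diff_distrib algebra_simps)
    also have "v \<bullet> (\<Sum>j<Suc N. \<Psi> (\<tau> N j) *v (?e (Suc j) - ?e j)) =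
        (\<Sum>j<Suc N. (transpose (\<Psi> (\<tau> N j)) *v v) \<bullet> (?e (Suc j) - ?e j))"
      by (simp only: inner_sum_right dot_matrix_vector_mult)
    finally have eq: "\<bar>(v \<bullet> Z 0 \<omega> + v \<bullet> (sqrt \<epsilon> *\<^sub>R double_sum T (Suc N) q \<omega>)) - (v \<bullet> Z 0 \<omega> + v \<bullet> D N \<omega>)\<bar>
        = sqrt \<epsilon> * \<bar>\<Sum>j<Suc N. (transpose (\<Psi> (\<tau> N j)) *v v) \<bullet> (?e (Suc j) - ?e j)\<bar>"
      using eps_pos by (simp only: abs_mult) simp
    have "\<bar>\<Sum>j<Suc N. (transpose (\<Psi> (\<tau> N j)) *v v) \<bullet> (?e (Suc j) - ?e j)\<bar>
        \<le> (\<Sum>j<Suc N. norm (transpose (\<Psi> (\<tau> N j)) *v v) * (d N (Suc j) q \<omega> + d N j q \<omega>))"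
    proof (rule order_trans[OF sum_abs sum_mono])
      fix j
      have "\<bar>(transpose (\<Psi> (\<tau> N j)) *v v) \<bullet> (?e (Suc j) - ?e j)\<bar>
         \<le> norm (transpose (\<Psi> (\<tau> N j)) *v v) * norm (?e (Suc j) - ?e j)" by (rule Cauchy_Schwarz_ineq2)
      also have "\<dots> \<le> norm (transpose (\<Psi> (\<tau> N j)) *v v) * (d N (Suc j) q \<omega> + d N j q \<omega>)"
        unfolding d_def dist_norm by (intro mult_left_mono norm_triangle_ineq4) auto
      finally show "\<bar>(transpose (\<Psi> (\<tau> N j)) *v v) \<bullet> (?e (Suc j) - ?e j)\<bar>
         \<le> norm (transpose (\<Psi> (\<tau> N j)) *v v) * (d N (Suc j) q \<omega> + d N j q \<omega>)" .
    qed
    then have "sqrt \<epsilon> * \<bar>\<Sum>j<Suc N. (transpose (\<Psi> (\<tau> N j)) *v v) \<bullet> (?e (Suc j) - ?e j)\<bar>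
      \<le> sqrt \<epsilon> * (\<Sum>j<Suc N. norm (transpose (\<Psi> (\<tau> N j)) *v v) * (d N (Suc j) q \<omega> + d N j q \<omega>))"
      using eps_pos by (intro mult_left_mono) auto
    then show "\<bar>(v \<bullet> Z 0 \<omega> + v \<bullet> (sqrt \<epsilon> *\<^sub>R double_sum T (Suc N) q \<omega>)) - (v \<bullet> Z 0 \<omega> + v \<bullet> D N \<omega>)\<bar>
       \<le> (\<Sum>j<Suc N. ?K j * (d N (Suc j) q \<omega> + d N j q \<omega>))"
      unfolding eq sum_distrib_left mult.assoc .
  qed
  have lim2: "E2 \<longlonglongrightarrow> expectation (\<lambda>\<omega>. cis (u \<bullet> Z T \<omega>))"
    unfolding E2_def
  proof (rule integral_dominated_convergence[where w="\<lambda>_. 1"])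
    \<comment> \<open>The grids contain countably many times, so one null set serves all of
      them.\<close>
    have "AE \<omega> in M. \<forall>N j. noise (\<tau> N j) \<omega> = sqrt \<epsilon> *\<^sub>R I (\<tau> N j) \<omega>"
      unfolding AE_all_countable
    proof (intro allI)
      fix N j show "AE \<omega> in M. noise (\<tau> N j) \<omega> = sqrt \<epsilon> *\<^sub>R I (\<tau> N j) \<omega>"
        using ZI[OF \<tau>0[of N j]] by eventually_elim (simp add: noise_def)
    qed
    then show "AE \<omega> in M. (\<lambda>N. cis (v \<bullet> Z 0 \<omega> + v \<bullet> D N \<omega>)) \<longlonglongrightarrow> cis (u \<bullet> Z T \<omega>)"
      using AE_space
    proof eventually_elim
      case (elim \<omega>)
      have "D N \<omega> = (\<Sum>j<Suc N. \<Psi> (\<tau> N j) *v (noise (\<tau> N (Suc j)) \<omega> - noise (\<tau> N j) \<omega>))" for N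
        unfolding D_def scaleR_sum_right using elim(1)
        by (intro sum.cong refl) (simp add: scaleR_diff_right[symmetric] matrix_vector_mult_scaleR)
      then have "(\<lambda>N. D N \<omega>) \<longlonglongrightarrow> \<Psi> T *v Z T \<omega> - Z 0 \<omega>"
        using noise_sum_tendsto[OF T elim(2)] by (simp only: \<tau>_def)
      then have "(\<lambda>N. cis (v \<bullet> Z 0 \<omega> + v \<bullet> D N \<omega>)) \<longlonglongrightarrow> cis (v \<bullet> Z 0 \<omega> + v \<bullet> (\<Psi> T *v Z T \<omega> - Z 0 \<omega>))"
        unfolding cis_conv_exp by (intro tendsto_intros)
      moreover have "v \<bullet> Z 0 \<omega> + v \<bullet> (\<Psi> T *v Z T \<omega> - Z 0 \<omega>) = u \<bullet> Z T \<omega>"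
        using \<Phi>\<Psi>[OF t] unfolding v_def
        by (simp add: dot_matrix_vector_mult[symmetric] inner_diff_right matrix_vector_mul_assoc)
      ultimately show ?case by simp
    qed
  qed (use Z_measurable Dm in auto)
  \<comment> \<open>The diagonal choice: each coarse grid is refined until the error in probability
    costs less than \<open>1 / real (Suc N)\<close>.\<close>
  have "\<exists>q. \<forall>N. q N > 0 \<and> norm (E1 N (q N) - E2 N) < 1 / real (Suc N)"
  proof (intro choice allI)
    fix N
    have "\<forall>\<^sub>F q in sequentially. norm (E1 N q - E2 N) < 1 / real (Suc N)"
      using lim1[of N] unfolding tendsto_iff dist_norm by simp
    then have "\<forall>\<^sub>F q in sequentially. q > 0 \<and> norm (E1 N q - E2 N) < 1 / real (Suc N)"
      using eventually_gt_at_top[of "0::nat"] by eventually_elim simp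
    then show "\<exists>q>0. norm (E1 N q - E2 N) < 1 / real (Suc N)"
      by (auto simp: eventually_sequentially)
  qed
  then obtain q where q: "\<And>N. q N > 0" "\<And>N. norm (E1 N (q N) - E2 N) < 1 / real (Suc N)" by blast
  have "(\<lambda>N. E1 N (q N) - E2 N) \<longlonglongrightarrow> 0"
    by (rule Lim_null_comparison[OF _ LIMSEQ_inverse_real_of_nat])
       (use q(2) in \<open>auto intro!: always_eventually less_imp_le simp: inverse_eq_divide\<close>)
  from tendsto_add[OF this lim2] have "(\<lambda>N. E1 N (q N)) \<longlonglongrightarrow> expectation (\<lambda>\<omega>. cis (u \<bullet> Z T \<omega>))" by simp
  moreover have "(\<lambda>N. E1 N (q N)) \<longlonglongrightarrow> c0 * complex_of_real (exp (- \<epsilon> / 2 * L))"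
    unfolding E1_def double_sum_characteristic[OF T zero_less_Suc q(1)] c0_def[symmetric] L_def
    by (intro tendsto_intros double_sum_variance T q)
  ultimately show ?thesis
    unfolding c0_def L_def v_def by (rule LIMSEQ_unique)
qed

section \<open>The noise Gramian and the Gaussian law\<close>

lemma cont_noise_matrix: "continuous_on {0..t} (\<lambda>s. \<Psi> s ** \<Gamma> s)"
  by (intro continuous_intros continuous_on_subset[OF cont_\<Psi>] continuous_on_subset[OF cont_\<Gamma>]) auto

text \<open>The controllability Gramian of the noise, transported back to time zero.\<close>

definition noise_gramian :: "real \<Rightarrow> real^'n^'n" where
  "noise_gramian t = integral {0..t} (\<lambda>s. (\<Psi> s ** \<Gamma> s) ** transpose (\<Psi> s ** \<Gamma> s))"

lemma noise_gramian_has_integral: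
  "((\<lambda>s. (\<Psi> s ** \<Gamma> s) ** transpose (\<Psi> s ** \<Gamma> s)) has_integral noise_gramian t) {0..t}"
  unfolding noise_gramian_def
  by (intro integrable_integral integrable_continuous_interval continuous_intros cont_noise_matrix)

lemma noise_gramian_quadratic_form:
  "v \<bullet> (noise_gramian t *v v) = integral {0..t} (\<lambda>s. (norm (transpose (\<Psi> s ** \<Gamma> s) *v v))\<^sup>2)"
proof -
  have "bounded_linear (\<lambda>A. v \<bullet> (A *v v))"
    by (intro bounded_linear_compose[OF bounded_linear_inner_right]
        bounded_bilinear.bounded_linear_left[OF bounded_bilinear_matrix_vector_mult])
  from has_integral_linear[OF noise_gramian_has_integral this]
  have "((\<lambda>s. v \<bullet> (((\<Psi> s ** \<Gamma> s) ** transpose (\<Psi> s ** \<Gamma> s)) *v v)) has_integral v \<bullet> (noise_gramian t *v v)) {0..t}"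
    by (simp add: o_def)
  moreover have "v \<bullet> ((B ** transpose B) *v v) = (norm (transpose B *v v))\<^sup>2" for B :: "real^'k^'n"
    by (simp only: matrix_vector_mul_assoc[symmetric] dot_matrix_vector_mult[of v B] dot_square_norm)
  ultimately show ?thesis by (simp only: integral_unique)
qed

lemma transpose_noise_gramian: "transpose (noise_gramian t) = noise_gramian t"
proof -
  have "((\<lambda>s. transpose ((\<Psi> s ** \<Gamma> s) ** transpose (\<Psi> s ** \<Gamma> s))) has_integral transpose (noise_gramian t)) {0..t}"
    using has_integral_linear[OF noise_gramian_has_integral bounded_linear_transpose] by (simp add: o_def)
  moreover have "transpose (B ** transpose B) = B ** transpose B" for B :: "real^'k^'n"
    by (simp add: matrix_transpose_mul)
  ultimately show ?thesis
    by (simp only: has_integral_unique[OF _ noise_gramian_has_integral])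
qed

lemma psd_noise_gramian: "psd (noise_gramian t)"
  unfolding psd_def noise_gramian_quadratic_form 
  by (intro allI integral_nonneg integrable_continuous_interval continuous_intros cont_noise_matrix) auto

definition covariance :: "real^'n^'n \<Rightarrow> real \<Rightarrow> real^'n^'n" where
  "covariance S t = \<Phi> t ** (S + \<epsilon> *\<^sub>R noise_gramian t) ** transpose (\<Phi> t)"

text \<open>The factor from \<open>Z 0\<close> at frequency \<open>transpose (\<Phi> t) *v u\<close>
  supplies the mean and the \<open>S\<close> part, the noise factor the Gramian part; congruence by
  \<open>\<Phi> t\<close> turns both into forms in \<open>u\<close>.\<close>

lemma solution_gaussian:
  assumes init_law: "gaussian_law M (Z 0) m S" and t: "t \<ge> 0"
  shows "gaussian_law M (Z t) (\<Phi> t *v m) (covariance S t)"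
  unfolding gaussian_law_def
proof (intro conjI allI)
  have S: "transpose S = S" "psd S" using init_law by (auto simp: gaussian_law_def)
  show "Z t \<in> borel_measurable M" by (rule Z_measurable)
  show "transpose (covariance S t) = covariance S t"
    by (simp add: covariance_def matrix_transpose_mul matrix_mul_assoc S transpose_noise_gramian
        linear_add[OF bounded_linear.linear, OF bounded_linear_transpose]
        linear_scale[OF bounded_linear.linear, OF bounded_linear_transpose])
  have form: "u \<bullet> (covariance S t *v u) = (transpose (\<Phi> t) *v u) \<bullet> (S *v (transpose (\<Phi> t) *v u)) +
      \<epsilon> * ((transpose (\<Phi> t) *v u) \<bullet> (noise_gramian t *v (transpose (\<Phi> t) *v u)))" for u
    by (simp add: covariance_def dot_congruence matrix_vector_mult_add_rdistrib inner_add_right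
        scaleR_matrix_vector_assoc[symmetric])
  show "psd (covariance S t)"
    using S(2) psd_noise_gramian[of t] eps_pos unfolding psd_def form by (auto intro: add_nonneg_nonneg)
  fix u
  let ?v = "transpose (\<Phi> t) *v u"
  have "expectation (\<lambda>\<omega>. cis (u \<bullet> Z t \<omega>)) =
      (cis (?v \<bullet> m) * complex_of_real (exp (- (?v \<bullet> (S *v ?v)) / 2))) *
      complex_of_real (exp (- \<epsilon> / 2 * (?v \<bullet> (noise_gramian t *v ?v))))"
    unfolding noise_gramian_quadratic_form solution_characteristic[OF t]
    using init_law unfolding gaussian_law_def by simp
  also have "\<dots> = cis (u \<bullet> (\<Phi> t *v m)) * complex_of_real (exp (- (u \<bullet> (covariance S t *v u)) / 2))"
    unfolding form dot_matrix_vector_mult[of u "\<Phi> t"] mult.assoc of_real_mult[symmetric] exp_add[symmetric]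
    by (simp add: field_simps)
  finally show "expectation (\<lambda>\<omega>. cis (u \<bullet> Z t \<omega>)) =
     cis (u \<bullet> (\<Phi> t *v m)) * complex_of_real (exp (- (u \<bullet> (covariance S t *v u)) / 2))" .
qed

end

section \<open>Periodic coefficients\<close>

lemma matrix_inv_unique:
  fixes A B :: "real^'n^'n"
  assumes "A ** B = mat 1" "B ** A = mat 1" shows "matrix_inv A = B"
proof -
  have "invertible A" using assms by (auto simp: invertible_def)
  then have "matrix_inv A ** (A ** B) = B" by (simp add: matrix_mul_assoc matrix_inv_inverse)
  then show ?thesis using assms by simp
qed

lemma power_stable_fixed_point:
  assumes "power_stable A" "A *v x = x" shows "x = 0"
proof -
  have "((*v) A ^^ k) x = x" for k by (induction k) (simp_all add: assms(2))
  then have "(\<lambda>k. ((*v) A ^^ k) x) = (\<lambda>k. x)" by (rule ext)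
  moreover have "(\<lambda>k. ((*v) A ^^ k) x) \<longlonglongrightarrow> 0" using assms(1) by (simp add: power_stable_def)
  ultimately show ?thesis by (simp only: LIMSEQ_const_iff)
qed

text \<open>Polarisation of the difference: its diagonal vanishes, and symmetry turns the mixed
  terms into twice one of them.\<close>

lemma symmetric_matrix_eqI:
  fixes S T :: "real^'n^'n"
  assumes "transpose S = S" "transpose T = T" and eq: "\<And>u. u \<bullet> (S *v u) = u \<bullet> (T *v u)"
  shows "S = T"
proof -
  define R where "R = S - T"
  have R: "u \<bullet> (R *v u) = 0" for u using eq by (simp add: R_def matrix_vector_mult_diff_rdistrib inner_diff_right)
  have sym: "x \<bullet> (R *v y) = y \<bullet> (R *v x)" for x y
  proof -
    have "transpose R = R"
      unfolding R_def by (simp only: linear_diff[OF bounded_linear.linear, OF bounded_linear_transpose] assms)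
    then show ?thesis using dot_matrix_vector_mult[of x R y] by (simp only: inner_commute[of y])
  qed
  have zero: "x \<bullet> (R *v y) = 0" for x y
  proof -
    have "(x + y) \<bullet> (R *v (x + y)) = x \<bullet> (R *v x) + x \<bullet> (R *v y) + (y \<bullet> (R *v x) + y \<bullet> (R *v y))"
      by (simp add: matrix_vector_right_distrib inner_add_left inner_add_right)
    then show ?thesis using R sym[of x y] by simp
  qed
  have "R = 0" unfolding matrix_eq_iff_dot by (simp add: zero)
  then show ?thesis by (simp add: R_def)
qed

text \<open>The modulus of the characteristic function gives the quadratic form, its phase the
  mean.\<close>

lemma gaussian_law_parameters_unique:
  assumes "gaussian_law M X m S" "gaussian_law M Y m' S'"
    and eq: "distr M borel X = distr M borel Y"
  shows "m = m'" "S = S'"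
proof -
  have X: "X \<in> borel_measurable M" "Y \<in> borel_measurable M" using assms by (auto simp: gaussian_law_def)
  have cf: "cis (u \<bullet> m) * complex_of_real (exp (- (u \<bullet> (S *v u)) / 2)) =
      cis (u \<bullet> m') * complex_of_real (exp (- (u \<bullet> (S' *v u)) / 2))" for u
  proof -
    have "(\<integral>\<omega>. cis (u \<bullet> X \<omega>) \<partial>M) = (\<integral>x. cis (u \<bullet> x) \<partial>distr M borel X)"
      using X by (subst integral_distr) auto
    also have "\<dots> = (\<integral>\<omega>. cis (u \<bullet> Y \<omega>) \<partial>M)"
      unfolding eq using X by (subst integral_distr) auto
    finally show ?thesis using assms(1,2) unfolding gaussian_law_def by metis
  qed
  have quad: "u \<bullet> (S *v u) = u \<bullet> (S' *v u)" for u
  proof -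
    have "norm (cis a * complex_of_real (exp r)) = exp r" for a r by (simp add: norm_mult)
    then show ?thesis using arg_cong[OF cf[of u], of norm] by simp
  qed
  have "transpose S = S" "transpose S' = S'" using assms(1,2) unfolding gaussian_law_def by blast+
  then show "S = S'" using quad by (rule symmetric_matrix_eqI)
  show "m = m'"
  proof (rule ccontr)
    assume "m \<noteq> m'"
    define w where "w = m - m'"
    \<comment> \<open>Phases are known only modulo \<open>2 * pi\<close>, so \<open>u\<close> is
      scaled to make the two phases differ by exactly 1, which \<open>sin 1 > 0\<close>
      distinguishes from zero.\<close>
    define u where "u = w /\<^sub>R (w \<bullet> w)"
    have w: "w \<noteq> 0" using \<open>m \<noteq> m'\<close> by (simp add: w_def)
    have "cis (u \<bullet> m) = cis (u \<bullet> m')" using cf[of u] unfolding quad[of u] by simp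
    then have "cis (u \<bullet> m) * cis (- (u \<bullet> m')) = 1" by (simp only: cis_mult) simp
    moreover have "u \<bullet> m + - (u \<bullet> m') = u \<bullet> w" by (simp add: w_def inner_diff_right)
    moreover have "u \<bullet> w = 1" using w by (simp add: u_def)
    ultimately have "cis 1 = 1" by (simp only: cis_mult)
    from arg_cong[OF this, of Im] have "sin 1 = (0::real)" by simp
    moreover have "sin 1 > (0::real)" using pi_gt3 by (intro sin_gt_zero) auto
    ultimately show False by simp
  qed
qed

locale periodic_linear_sde = linear_sde C \<Phi> M \<Gamma> \<epsilon> W Z
  for C \<Phi> :: "real \<Rightarrow> real^'n^'n" and M :: "'a measure"
    and \<Gamma> :: "real \<Rightarrow> real^'k^'n" and \<epsilon> :: real
    and W :: "real \<Rightarrow> 'a \<Rightarrow> real^'k" and Z :: "real \<Rightarrow> 'a \<Rightarrow> real^'n" +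
  fixes \<theta> :: real and m :: "real^'n" and S :: "real^'n^'n"
  assumes \<theta>: "\<theta> > 0" and C_periodic: "\<And>t. t \<ge> 0 \<Longrightarrow> C (t + \<theta>) = C t"
    and \<Gamma>_periodic: "\<And>t. t \<ge> 0 \<Longrightarrow> \<Gamma> (t + \<theta>) = \<Gamma> t"
    and stable: "power_stable (\<Phi> \<theta>)"
    and init_law: "gaussian_law M (Z 0) m S"
begin

lemma \<Phi>_period: "t \<ge> 0 \<Longrightarrow> \<Phi> (t + \<theta>) = \<Phi> t ** \<Phi> \<theta>"
  using \<Phi>_shift[OF C_periodic less_imp_le[OF \<theta>]] .

lemma \<Psi>_shift: assumes "t \<ge> 0" shows "\<Psi> (t + \<theta>) = \<Psi> \<theta> ** \<Psi> t"
proof (rule matrix_inv_unique)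
  have "\<Phi> (t + \<theta>) ** (\<Psi> \<theta> ** \<Psi> t) = \<Phi> t ** (\<Phi> \<theta> ** \<Psi> \<theta>) ** \<Psi> t"
    using \<Phi>_period \<theta> assms by (simp add: matrix_mul_assoc)
  then show "\<Phi> (t + \<theta>) ** (\<Psi> \<theta> ** \<Psi> t) = mat 1" using \<theta> assms by (simp add: \<Phi>\<Psi>)
  have "(\<Psi> \<theta> ** \<Psi> t) ** \<Phi> (t + \<theta>) = \<Psi> \<theta> ** (\<Psi> t ** \<Phi> t) ** \<Phi> \<theta>"
    using \<Phi>_period \<theta> assms by (simp add: matrix_mul_assoc)
  then show "(\<Psi> \<theta> ** \<Psi> t) ** \<Phi> (t + \<theta>) = mat 1" using \<theta> assms by (simp add: \<Psi>\<Phi>)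
qed

text \<open>After translating the part beyond the first period back by \<open>\<theta>\<close>, each
  integrand acquires a constant factor \<open>\<Psi> \<theta>\<close> on the left and its transpose
  on the right.\<close>

lemma noise_gramian_shift:
  assumes t: "t \<ge> 0"
  shows "noise_gramian (t + \<theta>) = noise_gramian \<theta> + \<Psi> \<theta> ** noise_gramian t ** transpose (\<Psi> \<theta>)"
proof -
  let ?f = "\<lambda>s. (\<Psi> s ** \<Gamma> s) ** transpose (\<Psi> s ** \<Gamma> s)"
  have cont: "continuous_on {0..r} ?f" for r
    by (intro continuous_intros cont_noise_matrix)
  have "noise_gramian (t + \<theta>) = integral {0..\<theta>} ?f + integral {\<theta>..t + \<theta>} ?f"
    unfolding noise_gramian_def using t \<theta>
    by (intro Henstock_Kurzweil_Integration.integral_combine[symmetric] integrable_continuous_interval cont) auto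
  also have "integral {\<theta>..t + \<theta>} ?f = integral {0..t} (?f \<circ> (\<lambda>s. s + \<theta>))"
    using integral_shift[of 0 \<theta> t ?f] continuous_on_subset[OF cont[of "t + \<theta>"], of "{\<theta>..t + \<theta>}"] \<theta> by simp
  also have "\<dots> = integral {0..t} (\<lambda>s. \<Psi> \<theta> ** ?f s ** transpose (\<Psi> \<theta>))"
    by (rule integral_cong) (simp add: \<Psi>_shift \<Gamma>_periodic matrix_transpose_mul matrix_mul_assoc)
  also have "\<dots> = \<Psi> \<theta> ** noise_gramian t ** transpose (\<Psi> \<theta>)"
    using has_integral_linear[OF noise_gramian_has_integral bounded_linear_congruence[of "\<Psi> \<theta>" "transpose (\<Psi> \<theta>)"], of t]
    by (intro integral_unique) (simp add: o_def)
  finally show ?thesis by (simp add: noise_gramian_def)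
qed

text \<open>The evolution can be restarted after one period from the covariance reached there. Hence
  a covariance fixed over the first period is periodic for all later times.\<close>

lemma covariance_shift:
  assumes t: "t \<ge> 0" shows "covariance T (t + \<theta>) = covariance (covariance T \<theta>) t"
proof -
  let ?A = "\<Phi> \<theta>" and ?B = "transpose (\<Phi> \<theta>)"
  have "?A ** (\<Psi> \<theta> ** noise_gramian t ** transpose (\<Psi> \<theta>)) ** ?B =
     (?A ** \<Psi> \<theta>) ** noise_gramian t ** transpose (?A ** \<Psi> \<theta>)"
    by (simp add: matrix_transpose_mul matrix_mul_assoc)
  also have "\<dots> = noise_gramian t" using \<theta> by (simp add: \<Phi>\<Psi> transpose_mat)
  finally have G: "?A ** (\<Psi> \<theta> ** noise_gramian t ** transpose (\<Psi> \<theta>)) ** ?B = noise_gramian t" .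
  interpret con: bounded_linear "\<lambda>X. ?A ** X ** ?B" by (rule bounded_linear_congruence)
  have "covariance T (t + \<theta>) = \<Phi> t ** (?A ** (T + \<epsilon> *\<^sub>R noise_gramian (t + \<theta>)) ** ?B) ** transpose (\<Phi> t)"
    using \<Phi>_period \<theta> t by (simp add: covariance_def matrix_transpose_mul matrix_mul_assoc)
  also have "?A ** (T + \<epsilon> *\<^sub>R noise_gramian (t + \<theta>)) ** ?B = covariance T \<theta> + \<epsilon> *\<^sub>R noise_gramian t"
    unfolding noise_gramian_shift[OF t] covariance_def by (simp add: con.add con.scaleR G scaleR_add_right)
  finally show ?thesis by (simp only: covariance_def[of "covariance T \<theta>" t])
qed

definition period_noise :: "real^'n^'n" where
  "period_noise = integral {0..\<theta>} (\<lambda>t. (\<Phi> \<theta> ** \<Psi> t ** \<Gamma> t) ** transpose (\<Phi> \<theta> ** \<Psi> t ** \<Gamma> t))"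

text \<open>The matrix of the Stein equation is the Gramian of one period carried forward to its
  end, which is the covariance gained from the noise.\<close>

lemma period_noise_eq: "period_noise = \<Phi> \<theta> ** noise_gramian \<theta> ** transpose (\<Phi> \<theta>)"
  unfolding period_noise_def
  using has_integral_linear[OF noise_gramian_has_integral bounded_linear_congruence[of "\<Phi> \<theta>" "transpose (\<Phi> \<theta>)"], of \<theta>]
  by (intro integral_unique) (simp add: o_def matrix_transpose_mul matrix_mul_assoc)

lemma transpose_period_noise: "transpose period_noise = period_noise"
  by (simp add: period_noise_eq matrix_transpose_mul matrix_mul_assoc transpose_noise_gramian)

lemma psd_period_noise: "psd period_noise"
  using psd_noise_gramian[of \<theta>] by (simp add: psd_def period_noise_eq dot_congruence)

lemma covariance_period: "covariance T \<theta> = \<Phi> \<theta> ** T ** transpose (\<Phi> \<theta>) + \<epsilon> *\<^sub>R period_noise"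
proof -
  interpret con: bounded_linear "\<lambda>X. \<Phi> \<theta> ** X ** transpose (\<Phi> \<theta>)" by (rule bounded_linear_congruence)
  show ?thesis by (simp add: covariance_def period_noise_eq con.add con.scaleR)
qed

lemma covariance_fixed_iff:
  "covariance T \<theta> = T \<longleftrightarrow> \<Phi> \<theta> ** T ** transpose (\<Phi> \<theta>) - T + \<epsilon> *\<^sub>R period_noise = 0"
  unfolding covariance_period by (auto simp: algebra_simps)

lemma stein_equation_ex1:
  "\<exists>!\<Sigma>. transpose \<Sigma> = \<Sigma> \<and> \<Phi> \<theta> ** \<Sigma> ** transpose (\<Phi> \<theta>) - \<Sigma> + \<epsilon> *\<^sub>R period_noise = 0"
  by (rule stein_ex1[OF stable])
    (simp add: transpose_period_noise linear_scale[OF bounded_linear.linear, OF bounded_linear_transpose])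

definition stationary_covariance :: "real^'n^'n" where
  "stationary_covariance = (THE \<Sigma>. transpose \<Sigma> = \<Sigma> \<and>
      \<Phi> \<theta> ** \<Sigma> ** transpose (\<Phi> \<theta>) - \<Sigma> + \<epsilon> *\<^sub>R period_noise = 0)"

lemma stationary_covariance:
  "transpose stationary_covariance = stationary_covariance"
  "\<Phi> \<theta> ** stationary_covariance ** transpose (\<Phi> \<theta>) - stationary_covariance + \<epsilon> *\<^sub>R period_noise = 0"
  using theI'[OF stein_equation_ex1] unfolding stationary_covariance_def by auto

lemma stationary_covarianceI:
  assumes "transpose T = T" "\<Phi> \<theta> ** T ** transpose (\<Phi> \<theta>) - T + \<epsilon> *\<^sub>R period_noise = 0"
  shows "T = stationary_covariance"
  using stein_equation_ex1 stationary_covariance assms by blast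

lemma psd_stationary_covariance: "psd stationary_covariance"
proof (rule stein_psd[OF stable _ stationary_covariance(2)])
  show "psd (\<epsilon> *\<^sub>R period_noise)"
    using psd_period_noise eps_pos by (simp add: psd_def scaleR_matrix_vector_assoc[symmetric])
qed

lemma covariance_stationary_periodic:
  "t \<ge> 0 \<Longrightarrow> covariance stationary_covariance (t + \<theta>) = covariance stationary_covariance t"
  by (simp add: covariance_shift covariance_fixed_iff[THEN iffD2, OF stationary_covariance(2)])

text \<open>Forwards, comparing the parameters of \<open>Z \<theta>\<close> and \<open>Z 0\<close>
  gives a fixed mean and a solution of the Stein equation. Backwards, equal parameters give equal
  characteristic functions, hence equal laws.\<close>

lemma periodic_law_iff:
  "(\<forall>t\<ge>0. distr M borel (Z (t + \<theta>)) = distr M borel (Z t)) \<longleftrightarrow> m = 0 \<and> S = stationary_covariance"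
proof
  assume "\<forall>t\<ge>0. distr M borel (Z (t + \<theta>)) = distr M borel (Z t)"
  then have "distr M borel (Z (0 + \<theta>)) = distr M borel (Z 0)" by blast
  then have "distr M borel (Z \<theta>) = distr M borel (Z 0)" by simp
  from gaussian_law_parameters_unique[OF solution_gaussian[OF init_law] init_law this] \<theta>
  have "\<Phi> \<theta> *v m = m" "covariance S \<theta> = S" by auto
  moreover have "transpose S = S" using init_law by (simp add: gaussian_law_def)
  ultimately show "m = 0 \<and> S = stationary_covariance"
    using power_stable_fixed_point[OF stable] stationary_covarianceI covariance_fixed_iff by blast
next
  assume a: "m = 0 \<and> S = stationary_covariance"
  show "\<forall>t\<ge>0. distr M borel (Z (t + \<theta>)) = distr M borel (Z t)"
  proof (intro allI impI)
    fix t :: real assume t: "t \<ge> 0"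
    have "gaussian_law M (Z (t + \<theta>)) 0 (covariance S (t + \<theta>))" "gaussian_law M (Z t) 0 (covariance S t)"
      using solution_gaussian[OF init_law, of "t + \<theta>"] solution_gaussian[OF init_law t] t \<theta> a by auto
    then show "distr M borel (Z (t + \<theta>)) = distr M borel (Z t)"
      using a covariance_stationary_periodic[OF t]
      by (intro distr_eqI_characteristic prob_space_axioms) (auto simp: gaussian_law_def)
  qed
qed

text \<open>Superposition in the rotated coordinates: the weighted sum of the \<open>T j\<close>
  solves the Stein equation with the diagonalised noise. Rotating back and scaling by
  \<open>\<epsilon>\<close> gives a symmetric solution of the original equation, which is
  unique.\<close>

lemma stationary_covariance_decomposition:
  fixes lam :: "'n \<Rightarrow> real"
  assumes G0: "orthogonal_matrix G0"
    and diag: "G0 ** period_noise ** transpose G0 = (\<Sum>j\<in>P. lam j *\<^sub>R Emat j)"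
    and A1: "A1 = G0 ** \<Phi> \<theta> ** transpose G0"
    and T: "\<And>j. j \<in> P \<Longrightarrow> transpose (T j) = T j"
      "\<And>j. j \<in> P \<Longrightarrow> A1 ** T j ** transpose A1 - T j + Emat j = 0"
  shows "stationary_covariance = \<epsilon> *\<^sub>R (transpose G0 ** (\<Sum>j\<in>P. lam j *\<^sub>R T j) ** G0)"
proof -
  define X where "X = (\<Sum>j\<in>P. lam j *\<^sub>R T j)"
  define Y where "Y = transpose G0 ** X ** G0"
  have GG: "transpose G0 ** G0 = mat 1" using G0 by (simp add: orthogonal_matrix_def)
  interpret tr: bounded_linear "transpose :: real^'n^'n \<Rightarrow> real^'n^'n" by (rule bounded_linear_transpose)
  interpret con1: bounded_linear "\<lambda>X. A1 ** X ** transpose A1" by (rule bounded_linear_congruence)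
  interpret con: bounded_linear "\<lambda>X. \<Phi> \<theta> ** X ** transpose (\<Phi> \<theta>)" by (rule bounded_linear_congruence)
  interpret conG: bounded_linear "\<lambda>X. transpose G0 ** X ** G0" by (rule bounded_linear_congruence)
  have "transpose X = X" unfolding X_def by (simp add: tr.sum tr.scaleR T(1))
  then have symY: "transpose Y = Y" by (simp add: Y_def matrix_transpose_mul matrix_mul_assoc)
  have "A1 ** X ** transpose A1 - X + G0 ** period_noise ** transpose G0
      = (\<Sum>j\<in>P. lam j *\<^sub>R (A1 ** T j ** transpose A1 - T j + Emat j))"
    unfolding diag X_def by (simp add: con1.sum con1.scaleR sum_subtractf sum.distrib scaleR_add_right scaleR_diff_right)
  also have "\<dots> = 0" using T(2) by simp
  finally have "transpose G0 ** (A1 ** X ** transpose A1 - X + G0 ** period_noise ** transpose G0) ** G0 = 0"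
    by simp
  then have eq: "transpose G0 ** (A1 ** X ** transpose A1) ** G0 - Y + transpose G0 ** (G0 ** period_noise ** transpose G0) ** G0 = 0"
    unfolding conG.add conG.diff Y_def .
  have "transpose G0 ** (A1 ** X ** transpose A1) ** G0 =
     (transpose G0 ** G0) ** \<Phi> \<theta> ** Y ** transpose (\<Phi> \<theta>) ** (transpose G0 ** G0)"
    by (simp only: A1 Y_def matrix_transpose_mul transpose_transpose matrix_mul_assoc)
  moreover have "transpose G0 ** (G0 ** period_noise ** transpose G0) ** G0 =
     (transpose G0 ** G0) ** period_noise ** (transpose G0 ** G0)"
    by (simp only: matrix_mul_assoc)
  ultimately have eqY: "\<Phi> \<theta> ** Y ** transpose (\<Phi> \<theta>) - Y + period_noise = 0"
    using eq by (simp only: GG matrix_mul_lid matrix_mul_rid)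
  have "\<Phi> \<theta> ** (\<epsilon> *\<^sub>R Y) ** transpose (\<Phi> \<theta>) - \<epsilon> *\<^sub>R Y + \<epsilon> *\<^sub>R period_noise
      = \<epsilon> *\<^sub>R (\<Phi> \<theta> ** Y ** transpose (\<Phi> \<theta>) - Y + period_noise)"
    by (simp only: con.scaleR scaleR_add_right scaleR_diff_right)
  then show ?thesis
    unfolding X_def[symmetric] Y_def[symmetric] eqY
    by (intro stationary_covarianceI[symmetric]) (simp_all add: tr.scaleR symY)
qed

lemma stationary_covariance_spectral:
  fixes lam :: "'n \<Rightarrow> real"
  assumes G0: "orthogonal_matrix G0"
    and diag: "G0 ** period_noise ** transpose G0 = (\<Sum>j\<in>P. lam j *\<^sub>R Emat j)"
  defines "A1 \<equiv> G0 ** \<Phi> \<theta> ** matrix_inv G0"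
  defines "S1 \<equiv> \<lambda>j. THE \<Sigma>. transpose \<Sigma> = \<Sigma> \<and> A1 ** \<Sigma> ** transpose A1 - \<Sigma> + Emat j = 0"
  shows "\<exists>!\<Sigma>. transpose \<Sigma> = \<Sigma> \<and> A1 ** \<Sigma> ** transpose A1 - \<Sigma> + Emat j = 0"
    and "psd (S1 j)"
    and "stationary_covariance = \<epsilon> *\<^sub>R (transpose G0 ** (\<Sum>j\<in>P. lam j *\<^sub>R S1 j) ** G0)"
proof -
  have A1: "A1 = G0 ** \<Phi> \<theta> ** transpose G0"
    unfolding A1_def using G0 by (subst matrix_inv_unique[of G0 "transpose G0"]) (auto simp: orthogonal_matrix_def)
  then have st: "power_stable A1" using power_stable_orthogonal_conj[OF stable G0] by simp
  show ex1: "\<exists>!\<Sigma>. transpose \<Sigma> = \<Sigma> \<and> A1 ** \<Sigma> ** transpose A1 - \<Sigma> + Emat j = 0" for j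
    by (rule stein_ex1[OF st transpose_Emat])
  have S1: "transpose (S1 j) = S1 j" "A1 ** S1 j ** transpose A1 - S1 j + Emat j = 0" for j
    using theI'[OF ex1[of j]] unfolding S1_def by auto
  show "psd (S1 j)" by (rule stein_psd[OF st psd_Emat S1(2)])
  show "stationary_covariance = \<epsilon> *\<^sub>R (transpose G0 ** (\<Sum>j\<in>P. lam j *\<^sub>R S1 j) ** G0)"
    by (rule stationary_covariance_decomposition[OF G0 diag A1 S1])
qed

end

text \<open>The increasing positions of the nonzero eigenvalues are encoded as the set
  \<open>P\<close>, and the eigenvalues as a function \<open>lam\<close> of the position. Uniqueness
  of the Stein solutions is part of the conclusion, so the \<open>THE\<close> terms are
  meaningful.\<close>

theorem theorem3p1:
  fixes \<theta> \<epsilon> :: real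
    and C :: "real \<Rightarrow> real^'n^'n"
    and \<Gamma> :: "real \<Rightarrow> real^'k^'n"
    and \<Phi> :: "real \<Rightarrow> real^'n^'n"
    and M :: "'a measure"
    and W :: "real \<Rightarrow> 'a \<Rightarrow> real^'k"
    and Z :: "real \<Rightarrow> 'a \<Rightarrow> real^'n"
    and m :: "real^'n" and S :: "real^'n^'n"
  assumes "\<theta> > 0" and "\<epsilon> > 0"
    and "continuous_on {0..} C" and "continuous_on {0..} \<Gamma>"
    and "\<forall>t\<ge>0. C (t + \<theta>) = C t" and "\<forall>t\<ge>0. \<Gamma> (t + \<theta>) = \<Gamma> t"
    and "\<forall>t\<ge>0. (\<Phi> has_vector_derivative (C t ** \<Phi> t)) (at t within {0..})"
    and "\<Phi> 0 = mat 1"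
    and "CM_bar (\<Phi> \<theta>)"
    and "prob_space M"
    and "std_brownian_motion M W"
    and "gaussian_law M (Z 0) m S"
    and "prob_space.indep_set M (sets (vimage_algebra (space M) (Z 0) borel))
       (sets (vimage_algebra (space M) (\<lambda>\<omega> t. W t \<omega>) (Pi\<^sub>M UNIV (\<lambda>_. borel))))"
    and "linear_sde_solution M C \<Gamma> \<epsilon> W Z"
  shows
    "(\<forall>t\<ge>0. gaussian_law M (Z t) (\<Phi> t *v m)
        (\<Phi> t ** (S + \<epsilon> *\<^sub>R integral {0..t}
           (\<lambda>s. (matrix_inv (\<Phi> s) ** \<Gamma> s) ** transpose (matrix_inv (\<Phi> s) ** \<Gamma> s)))
         ** transpose (\<Phi> t)))
     \<and>
     (let Mm = integral {0..\<theta>} (\<lambda>t. (\<Phi> \<theta> ** matrix_inv (\<Phi> t) ** \<Gamma> t)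
                                  ** transpose (\<Phi> \<theta> ** matrix_inv (\<Phi> t) ** \<Gamma> t));
          Sc0 = (THE \<Sigma>. transpose \<Sigma> = \<Sigma> \<and>
                   \<Phi> \<theta> ** \<Sigma> ** transpose (\<Phi> \<theta>) - \<Sigma> + \<epsilon> *\<^sub>R Mm = 0);
          Sc = (\<lambda>t. \<Phi> t ** (Sc0 + \<epsilon> *\<^sub>R integral {0..t}
                   (\<lambda>s. (matrix_inv (\<Phi> s) ** \<Gamma> s) ** transpose (matrix_inv (\<Phi> s) ** \<Gamma> s)))
                 ** transpose (\<Phi> t))
      in
      (\<exists>!\<Sigma>. transpose \<Sigma> = \<Sigma> \<and> \<Phi> \<theta> ** \<Sigma> ** transpose (\<Phi> \<theta>) - \<Sigma> + \<epsilon> *\<^sub>R Mm = 0) \<and>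
      ((\<forall>t\<ge>0. distr M borel (Z (t + \<theta>)) = distr M borel (Z t)) \<longleftrightarrow> (m = 0 \<and> S = Sc0)) \<and>
      (m = 0 \<and> S = Sc0 \<longrightarrow> (\<forall>t\<ge>0. gaussian_law M (Z t) 0 (Sc t))) \<and>
      (\<forall>t\<ge>0. Sc (t + \<theta>) = Sc t) \<and>
      (\<forall>G0 P (lam :: 'n \<Rightarrow> real).
         orthogonal_matrix G0 \<and> card P = rank Mm \<and> (\<forall>j\<in>P. lam j > 0) \<and>
         G0 ** Mm ** transpose G0 = (\<Sum>j\<in>P. lam j *\<^sub>R Emat j) \<longrightarrow>
         (let A1 = G0 ** \<Phi> \<theta> ** matrix_inv G0;
              S1 = (\<lambda>j. THE \<Sigma>. transpose \<Sigma> = \<Sigma> \<and>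
                       A1 ** \<Sigma> ** transpose A1 - \<Sigma> + Emat j = 0)
          in (\<forall>j\<in>P. (\<exists>!\<Sigma>. transpose \<Sigma> = \<Sigma> \<and> A1 ** \<Sigma> ** transpose A1 - \<Sigma> + Emat j = 0)
                      \<and> psd (S1 j)) \<and>
             Sc0 = \<epsilon> *\<^sub>R (transpose G0 ** (\<Sum>j\<in>P. lam j *\<^sub>R S1 j) ** G0) \<and>
             psd Sc0)))"
proof -
  interpret prob_space M by fact
  interpret fundamental_matrix C \<Phi>
    by unfold_locales (use assms in auto)
  interpret linear_sde C \<Phi> M \<Gamma> \<epsilon> W Z
    by unfold_locales (use assms in auto)
  \<comment> \<open>Here the spectral assumption enters, as power stability of the monodromy matrix
    \<open>\<Phi> \<theta>\<close>.\<close>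
  interpret periodic_linear_sde C \<Phi> M \<Gamma> \<epsilon> W Z \<theta> m S
    by unfold_locales (use assms CM_bar_imp_power_stable in auto)
  have a: "\<forall>t\<ge>0. gaussian_law M (Z t) (\<Phi> t *v m) (covariance S t)"
    using solution_gaussian[OF init_law] by blast
  have b: "m = 0 \<and> S = stationary_covariance \<longrightarrow> (\<forall>t\<ge>0. gaussian_law M (Z t) 0 (covariance stationary_covariance t))"
    using a by auto
  show ?thesis
    unfolding Let_def period_noise_def[symmetric] stationary_covariance_def[symmetric]
      noise_gramian_def[symmetric] covariance_def[symmetric]
  proof (intro conjI a b stein_equation_ex1 periodic_law_iff)
    show "\<forall>t\<ge>0. covariance stationary_covariance (t + \<theta>) = covariance stationary_covariance t"
      using covariance_stationary_periodic by blast
  qed (intro allI impI, elim conjE, intro conjI ballI psd_stationary_covariance,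
      (rule stationary_covariance_spectral; assumption)+)
qed

end
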